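(* Let $X$ be a nonempty set and let $\theta\in\mathscr{T}_X$. The cross-connection semigroup $(\Pi_\theta,\mathscr{P}_\theta;\Gamma_\theta)$ is isomorphic to the semigroup $Reg(\mathscr{T}_X^\theta)$ of regular elements of $\mathscr{T}_X^\theta$, such that the $\mathcal{L}$ category of $Reg(\mathscr{T}_X^\theta)$ is isomorphic to $\mathscr{P}_\theta$ and the $\mathcal{R}$ category of $Reg(\mathscr{T}_X^\theta)$ is isomorphic to $\Pi_\theta$.
   Context: Functions are written on the right and composed from left to right. $\mathscr{T}_X$ is the semigroup of all maps $X\to X$ under composition. The variant $\mathscr{T}_X^\theta$ is the set $\mathscr{T}_X$ with the operation $\alpha*\beta=\alpha\theta\beta$; its regular elements form a regular subsemigroup $Reg(\mathscr{T}_X^\theta)$. For $a\in\mathscr{T}_X$, $\mathrm{Im}\,a$ is its image and $\pi_a$ is the partition of $X$ into the nonempty fibres of $a$. A subset $A\subseteq X$ saturates a partition $\pi$ of $X$ if each $\pi$-class contains at least one element of $A$; $\pi$ separates $A$ if each $\pi$-class contains at most one element of $A$. $\mathcal{L}$ and $\mathcal{R}$ categories of a regular semigroup $S$ (with idempotent set $E(S)$): the objects of $\mathcal{L}$ are the principal left ideals $Se$, $e\in E(S)$, and the morphisms $Se\to Sf$ are the maps $\rho(e,u,f):x\mapsto xu$ with $u\in eSf$. The objects of $\mathcal{R}$ are the principal right ideals $eS$, $e\in E(S)$, and the morphisms $eS\to fS$ are the maps $\lambda(e,w,f):x\mapsto wx$ with $w\in fSe$. $\mathscr{P}_\theta$ is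 the category whose objects are the nonempty subsets $A\subseteq X$ separated by $\pi_\theta$, with all maps as morphisms. For a partition $\pi$ of $X$, $\bar\pi$ is the set of all maps from $\pi$ to $X$, regarded as maps $X\to X$ constant on $\pi$-classes; $\Pi_\theta$ is the category with objects $\{\bar\pi:\mathrm{Im}\,\theta\text{ saturates }\pi\}$, a morphism $\eta^*:\bar\pi_1\to\bar\pi_2$ being given by a map $\eta:\pi_2\to\pi_1$ via $\alpha\mapsto\eta\alpha$ for $\alpha\in\bar\pi_1$. The cross-connection $\Gamma_\theta$ sends $\bar\pi\in v\Pi_\theta$ to $\theta^*(\bar\pi)=\overline{(\pi)\theta^{-1}}$, where $(\pi)\theta^{-1}$ is the partition of $X$ into the inverse images under $\theta$ of the $\pi$-classes; the dual cross-connection $\Delta_\theta$ sends $A\in v\mathscr{P}_\theta$ to $A\theta$. For objects $A$ of $\mathscr{P}_\theta$ and $\bar\pi$ of $\Pi_\theta$ the associated bifunctors take the values $$\Gamma_\theta(A,\bar\pi)=\{b\in\mathscr{T}_X:\mathrm{Im}\,b\subseteq A,\ \bar\pi_b\subseteq\theta^*(\bar\pi)\},\qquad \Delta_\theta(A,\bar\pi)=\{b\in\mathscr{T}_X:\mathrm{Im}\,b\subseteq A\theta,\ \bar\pi_b\subseteq\bar\pi\},$$ where $\bar\pi_b=\overline{\pi_b}$, and the duality $\chi_{\Gamma_\theta}(A,\bar\pi):\Gamma_\theta(A,\bar\pi)\to\Delta_\theta(A,\bar\pi)$ is the bijection $\theta a\mapsto a\theta$, for $a\in\mathscr{T}_X$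 with $\mathrm{Im}\,a\subseteq A$ and $\bar\pi_a\subseteq\bar\pi$. An element $\gamma$ is linked to $\delta$ if there is $(A,\bar\pi)$ with $\gamma\in\Gamma_\theta(A,\bar\pi)$ and $\delta=\chi_{\Gamma_\theta}(A,\bar\pi)(\gamma)$. The cross-connection semigroup $(\Pi_\theta,\mathscr{P}_\theta;\Gamma_\theta)$ is the set of all linked pairs $(\gamma,\delta)$, explicitly $$\{(\theta a,a\theta):a\in Reg(\mathscr{T}_X^\theta)\},$$ with the componentwise multiplication inherited from $\mathscr{T}_X\times\mathscr{T}_X$. *)

theory Defs
  imports "HOL-Library.FuncSet" "HOL-Library.Disjoint_Sets"
begin

section \<open>Semigroups on a carrier set\<close>

record 'a sgrp =
  elems :: "'a set"
  mul :: "'a \<Rightarrow> 'a \<Rightarrow> 'a"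

definition is_semigroup :: "'a sgrp \<Rightarrow> bool" where
  "is_semigroup S \<longleftrightarrow>
     (\<forall>a\<in>elems S. \<forall>b\<in>elems S. mul S a b \<in> elems S) \<and>
     (\<forall>a\<in>elems S. \<forall>b\<in>elems S. \<forall>c\<in>elems S. mul S (mul S a b) c = mul S a (mul S b c))"

definition semigroup_isomorphic :: "'a sgrp \<Rightarrow> 'b sgrp \<Rightarrow> bool" where
  "semigroup_isomorphic S T \<longleftrightarrow> is_semigroup S \<and> is_semigroup T \<and>
     (\<exists>\<phi>. bij_betw \<phi> (elems S) (elems T) \<and>
          (\<forall>a\<in>elems S. \<forall>b\<in>elems S. \<phi> (mul S a b) = mul T (\<phi> a) (\<phi> b)))"

definition regular_part :: "'a sgrp \<Rightarrow> 'a sgrp" where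
  "regular_part S =
     \<lparr>elems = {a \<in> elems S. \<exists>b\<in>elems S. mul S (mul S a b) a = a}, mul = mul S\<rparr>"

definition idempotents :: "'a sgrp \<Rightarrow> 'a set" where
  "idempotents S = {e \<in> elems S. mul S e e = e}"

text \<open>Since \<open>e\<close> is always idempotent below, \<open>Se\<close> contains \<open>e\<close> and is the principal left
  ideal generated by \<open>e\<close>; dually for \<open>eS\<close>.\<close>

definition left_ideal :: "'a sgrp \<Rightarrow> 'a \<Rightarrow> 'a set" where
  "left_ideal S e = {mul S s e | s. s \<in> elems S}"

definition right_ideal :: "'a sgrp \<Rightarrow> 'a \<Rightarrow> 'a set" where
  "right_ideal S e = {mul S e s | s. s \<in> elems S}"


section \<open>Categories\<close>

text \<open>Hom-sets for different pairs of objects need not be disjoint, so identities, composition and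
  the morphism part of a functor are indexed by objects. \<open>Comp C A B D f g\<close> is the composite
  ``first \<open>f : A \<rightarrow> B\<close>, then \<open>g : B \<rightarrow> D\<close>''.\<close>

record ('o, 'm) cat =
  Ob :: "'o set"
  Hom :: "'o \<Rightarrow> 'o \<Rightarrow> 'm set"
  Ident :: "'o \<Rightarrow> 'm"
  Comp :: "'o \<Rightarrow> 'o \<Rightarrow> 'o \<Rightarrow> 'm \<Rightarrow> 'm \<Rightarrow> 'm"

definition is_category :: "('o, 'm) cat \<Rightarrow> bool" where
  "is_category C \<longleftrightarrow>
     (\<forall>A\<in>Ob C. Ident C A \<in> Hom C A A) \<and>
     (\<forall>A\<in>Ob C. \<forall>B\<in>Ob C. \<forall>D\<in>Ob C. \<forall>f\<in>Hom C A B. \<forall>g\<in>Hom C B D.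
        Comp C A B D f g \<in> Hom C A D) \<and>
     (\<forall>A\<in>Ob C. \<forall>B\<in>Ob C. \<forall>f\<in>Hom C A B.
        Comp C A A B (Ident C A) f = f \<and> Comp C A B B f (Ident C B) = f) \<and>
     (\<forall>A\<in>Ob C. \<forall>B\<in>Ob C. \<forall>D\<in>Ob C. \<forall>E\<in>Ob C.
      \<forall>f\<in>Hom C A B. \<forall>g\<in>Hom C B D. \<forall>h\<in>Hom C D E.
        Comp C A D E (Comp C A B D f g) h = Comp C A B E f (Comp C B D E g h))"

definition is_functor ::
    "('o, 'm) cat \<Rightarrow> ('p, 'n) cat \<Rightarrow> ('o \<Rightarrow> 'p) \<Rightarrow> ('o \<Rightarrow> 'o \<Rightarrow> 'm \<Rightarrow> 'n) \<Rightarrow> bool" where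
  "is_functor C D F0 F1 \<longleftrightarrow> is_category C \<and> is_category D \<and>
     (\<forall>A\<in>Ob C. F0 A \<in> Ob D \<and> F1 A A (Ident C A) = Ident D (F0 A)) \<and>
     (\<forall>A\<in>Ob C. \<forall>B\<in>Ob C. \<forall>f\<in>Hom C A B. F1 A B f \<in> Hom D (F0 A) (F0 B)) \<and>
     (\<forall>A\<in>Ob C. \<forall>B\<in>Ob C. \<forall>E\<in>Ob C. \<forall>f\<in>Hom C A B. \<forall>g\<in>Hom C B E.
        F1 A E (Comp C A B E f g) = Comp D (F0 A) (F0 B) (F0 E) (F1 A B f) (F1 B E g))"

definition cat_isomorphic :: "('o, 'm) cat \<Rightarrow> ('p, 'n) cat \<Rightarrow> bool" where
  "cat_isomorphic C D \<longleftrightarrow>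
     (\<exists>F0 F1 G0 G1. is_functor C D F0 F1 \<and> is_functor D C G0 G1 \<and>
        (\<forall>A\<in>Ob C. G0 (F0 A) = A) \<and>
        (\<forall>A\<in>Ob C. \<forall>B\<in>Ob C. \<forall>f\<in>Hom C A B. G1 (F0 A) (F0 B) (F1 A B f) = f) \<and>
        (\<forall>A\<in>Ob D. F0 (G0 A) = A) \<and>
        (\<forall>A\<in>Ob D. \<forall>B\<in>Ob D. \<forall>f\<in>Hom D A B. F1 (G0 A) (G0 B) (G1 A B f) = f))"

text \<open>A category whose objects are sets and whose morphisms \<open>A \<rightarrow> B\<close> are maps of sets, with the usual
  identities and composition. Maps with domain \<open>A\<close> are represented by extensional functions
  (\<open>undefined\<close> outside \<open>A\<close>), so that equal maps are equal functions.\<close>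

definition set_category :: "'a set set \<Rightarrow> ('a set \<Rightarrow> 'a set \<Rightarrow> ('a \<Rightarrow> 'a) set)
    \<Rightarrow> ('a set, 'a \<Rightarrow> 'a) cat" where
  "set_category Obs Homs =
     \<lparr>Ob = Obs, Hom = Homs, Ident = (\<lambda>A. \<lambda>x\<in>A. x), Comp = (\<lambda>A B D f g. compose A g f)\<rparr>"


section \<open>The categories of principal left and right ideals\<close>

text \<open>\<open>rho_map S e u\<close> is \<open>\<rho>(e,u,f) : Se \<rightarrow> Sf\<close> and \<open>lambda_map S e w\<close> is \<open>\<lambda>(e,w,f) : eS \<rightarrow> fS\<close>; the
  idempotent \<open>f\<close> only enters through the codomain and the condition on \<open>u\<close>, \<open>w\<close>.\<close>

definition rho_map :: "'a sgrp \<Rightarrow> 'a \<Rightarrow> 'a \<Rightarrow> 'a \<Rightarrow> 'a" where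
  "rho_map S e u = (\<lambda>x\<in>left_ideal S e. mul S x u)"

definition lambda_map :: "'a sgrp \<Rightarrow> 'a \<Rightarrow> 'a \<Rightarrow> 'a \<Rightarrow> 'a" where
  "lambda_map S e w = (\<lambda>x\<in>right_ideal S e. mul S w x)"

definition sandwich :: "'a sgrp \<Rightarrow> 'a \<Rightarrow> 'a \<Rightarrow> 'a set" where
  "sandwich S e f = {mul S (mul S e s) f | s. s \<in> elems S}"

definition L_category :: "'a sgrp \<Rightarrow> ('a set, 'a \<Rightarrow> 'a) cat" where
  "L_category S = set_category
     {left_ideal S e | e. e \<in> idempotents S}
     (\<lambda>V W. {rho_map S e u | e u f. e \<in> idempotents S \<and> f \<in> idempotents S \<and>
               V = left_ideal S e \<and> W = left_ideal S f \<and> u \<in> sandwich S e f})"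

definition R_category :: "'a sgrp \<Rightarrow> ('a set, 'a \<Rightarrow> 'a) cat" where
  "R_category S = set_category
     {right_ideal S e | e. e \<in> idempotents S}
     (\<lambda>V W. {lambda_map S e w | e w f. e \<in> idempotents S \<and> f \<in> idempotents S \<and>
               V = right_ideal S e \<and> W = right_ideal S f \<and> w \<in> sandwich S f e})"


section \<open>Transformations, variants and partitions\<close>

text \<open>The nonempty set \<open>X\<close> is the universe of the type \<open>'x\<close>. Maps are composed from left to right:
  \<open>\<alpha> \<circ>> \<beta>\<close> is \<open>\<alpha>\<close> followed by \<open>\<beta>\<close>.\<close>

notation fcomp (infixl "\<circ>>" 60)

definition variant :: "('x \<Rightarrow> 'x) \<Rightarrow> ('x \<Rightarrow> 'x) sgrp" where
  "variant \<theta> = \<lparr>elems = UNIV, mul = (\<lambda>\<alpha> \<beta>. \<alpha> \<circ>> \<theta> \<circ>> \<beta>)\<rparr>"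

definition fibres :: "('x \<Rightarrow> 'x) \<Rightarrow> 'x set set" where
  "fibres a = {a -` {y} | y. y \<in> range a}"

definition saturates :: "'x set \<Rightarrow> 'x set set \<Rightarrow> bool" where
  "saturates A \<pi> \<longleftrightarrow> (\<forall>K\<in>\<pi>. K \<inter> A \<noteq> {})"

definition separates :: "'x set set \<Rightarrow> 'x set \<Rightarrow> bool" where
  "separates \<pi> A \<longleftrightarrow> (\<forall>K\<in>\<pi>. \<forall>x\<in>K \<inter> A. \<forall>y\<in>K \<inter> A. x = y)"

text \<open>\<open>bar \<pi>\<close> is the set \<open>\<pi>\<close> with an overline: the maps \<open>\<pi> \<rightarrow> X\<close>, regarded as maps \<open>X \<rightarrow> X\<close>.\<close>

definition bar :: "'x set set \<Rightarrow> ('x \<Rightarrow> 'x) set" where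
  "bar \<pi> = {\<alpha>. \<forall>K\<in>\<pi>. \<forall>x\<in>K. \<forall>y\<in>K. \<alpha> x = \<alpha> y}"


section \<open>The categories of subsets and of partitions\<close>

definition P_category :: "('x \<Rightarrow> 'x) \<Rightarrow> ('x set, 'x \<Rightarrow> 'x) cat" where
  "P_category \<theta> = set_category
     {A. A \<noteq> {} \<and> separates (fibres \<theta>) A}
     (\<lambda>A B. A \<rightarrow>\<^sub>E B)"

definition class_of :: "'x set set \<Rightarrow> 'x \<Rightarrow> 'x set" where
  "class_of \<pi> x = (THE K. K \<in> \<pi> \<and> x \<in> K)"

text \<open>\<open>star_map \<pi>\<^sub>1 \<pi>\<^sub>2 \<eta>\<close> is \<open>\<eta>\<^sup>*\<close>: for \<open>\<alpha>\<close> in \<open>bar \<pi>\<^sub>1\<close>, the composite \<open>\<eta>\<alpha>\<close> sends a class of \<open>\<pi>\<^sub>2\<close> to the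
  common value of \<open>\<alpha>\<close> on its image class under \<open>\<eta>\<close>.\<close>

definition star_map :: "'x set set \<Rightarrow> 'x set set \<Rightarrow> ('x set \<Rightarrow> 'x set)
    \<Rightarrow> ('x \<Rightarrow> 'x) \<Rightarrow> ('x \<Rightarrow> 'x)" where
  "star_map \<pi>1 \<pi>2 \<eta> = (\<lambda>\<alpha>\<in>bar \<pi>1. \<lambda>x. the_elem (\<alpha> ` \<eta> (class_of \<pi>2 x)))"

definition Pi_category :: "('x \<Rightarrow> 'x) \<Rightarrow> (('x \<Rightarrow> 'x) set, ('x \<Rightarrow> 'x) \<Rightarrow> ('x \<Rightarrow> 'x)) cat" where
  "Pi_category \<theta> = set_category
     {bar \<pi> | \<pi>. partition_on UNIV \<pi> \<and> saturates (range \<theta>) \<pi>}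
     (\<lambda>V W. {star_map \<pi>1 \<pi>2 \<eta> | \<pi>1 \<pi>2 \<eta>.
               partition_on UNIV \<pi>1 \<and> saturates (range \<theta>) \<pi>1 \<and>
               partition_on UNIV \<pi>2 \<and> saturates (range \<theta>) \<pi>2 \<and>
               V = bar \<pi>1 \<and> W = bar \<pi>2 \<and> \<eta> \<in> \<pi>2 \<rightarrow> \<pi>1})"


section \<open>The cross-connection semigroup\<close>

text \<open>The partition underlying an object \<open>bar \<pi>\<close>; see \<open>partition_of_bar\<close>.\<close>

definition partition_of :: "('x \<Rightarrow> 'x) set \<Rightarrow> 'x set set" where
  "partition_of V = (THE \<pi>. partition_on UNIV \<pi> \<and> bar \<pi> = V)"

definition theta_star :: "('x \<Rightarrow> 'x) \<Rightarrow> ('x \<Rightarrow> 'x) set \<Rightarrow> ('x \<Rightarrow> 'x) set" where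
  "theta_star \<theta> V = bar {\<theta> -` K | K. K \<in> partition_of V}"

definition Gamma :: "('x \<Rightarrow> 'x) \<Rightarrow> 'x set \<Rightarrow> ('x \<Rightarrow> 'x) set \<Rightarrow> ('x \<Rightarrow> 'x) set" where
  "Gamma \<theta> A V = {b. range b \<subseteq> A \<and> bar (fibres b) \<subseteq> theta_star \<theta> V}"

definition Delta :: "('x \<Rightarrow> 'x) \<Rightarrow> 'x set \<Rightarrow> ('x \<Rightarrow> 'x) set \<Rightarrow> ('x \<Rightarrow> 'x) set" where
  "Delta \<theta> A V = {b. range b \<subseteq> \<theta> ` A \<and> bar (fibres b) \<subseteq> V}"

text \<open>The duality \<open>\<theta>a \<mapsto> a\<theta>\<close>; see \<open>chi_bij\<close> and \<open>chi_eq\<close>.\<close>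

definition chi :: "('x \<Rightarrow> 'x) \<Rightarrow> 'x set \<Rightarrow> ('x \<Rightarrow> 'x) set \<Rightarrow> ('x \<Rightarrow> 'x) \<Rightarrow> ('x \<Rightarrow> 'x)" where
  "chi \<theta> A V \<gamma> =
     (THE \<delta>. \<exists>a. range a \<subseteq> A \<and> bar (fibres a) \<subseteq> V \<and> \<gamma> = \<theta> \<circ>> a \<and> \<delta> = a \<circ>> \<theta>)"

definition linked :: "('x \<Rightarrow> 'x) \<Rightarrow> ('x \<Rightarrow> 'x) \<Rightarrow> ('x \<Rightarrow> 'x) \<Rightarrow> bool" where
  "linked \<theta> \<gamma> \<delta> \<longleftrightarrow>
     (\<exists>A\<in>Ob (P_category \<theta>). \<exists>V\<in>Ob (Pi_category \<theta>). \<gamma> \<in> Gamma \<theta> A V \<and> \<delta> = chi \<theta> A V \<gamma>)"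

definition cross_connection_semigroup :: "('x \<Rightarrow> 'x) \<Rightarrow> (('x \<Rightarrow> 'x) \<times> ('x \<Rightarrow> 'x)) sgrp" where
  "cross_connection_semigroup \<theta> =
     \<lparr>elems = {(\<gamma>, \<delta>). linked \<theta> \<gamma> \<delta>},
      mul = (\<lambda>(\<gamma>, \<delta>) (\<gamma>', \<delta>'). (\<gamma> \<circ>> \<gamma>', \<delta> \<circ>> \<delta>'))\<rparr>"


section \<open>Consistency of the definitions\<close>

lemma bar_fibres_subset_iff: "bar (fibres a) \<subseteq> bar \<pi> \<longleftrightarrow> a \<in> bar \<pi>"
proof
  have "a \<in> bar (fibres a)" by (auto simp: bar_def fibres_def)
  then show "bar (fibres a) \<subseteq> bar \<pi> \<Longrightarrow> a \<in> bar \<pi>" by blast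
next
  assume a: "a \<in> bar \<pi>"
  show "bar (fibres a) \<subseteq> bar \<pi>"
  proof
    fix \<alpha> assume al: "\<alpha> \<in> bar (fibres a)"
    have "\<alpha> x = \<alpha> y" if "K \<in> \<pi>" "x \<in> K" "y \<in> K" for K x y
    proof -
      have "a x = a y" using a that unfolding bar_def by blast
      then have "x \<in> a -` {a x}" "y \<in> a -` {a x}" "a -` {a x} \<in> fibres a"
        by (auto simp: fibres_def)
      then show ?thesis using al unfolding bar_def by blast
    qed
    then show "\<alpha> \<in> bar \<pi>" unfolding bar_def by blast
  qed
qed

lemma same_class:
  "partition_on A \<pi> \<Longrightarrow> K \<in> \<pi> \<Longrightarrow> L \<in> \<pi> \<Longrightarrow> x \<in> K \<Longrightarrow> x \<in> L \<Longrightarrow> K = L"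
  by (metis IntI disjointD empty_iff partition_onD2)

lemma bar_same_class_iff:
  fixes \<pi> :: "'x set set"
  assumes p: "partition_on UNIV \<pi>"
  shows "(\<exists>K\<in>\<pi>. x \<in> K \<and> y \<in> K) \<longleftrightarrow> (\<forall>\<alpha>\<in>bar \<pi>. \<alpha> x = \<alpha> y)"
proof
  assume "\<exists>K\<in>\<pi>. x \<in> K \<and> y \<in> K"
  then show "\<forall>\<alpha>\<in>bar \<pi>. \<alpha> x = \<alpha> y" by (auto simp: bar_def)
next
  assume all: "\<forall>\<alpha>\<in>bar \<pi>. \<alpha> x = \<alpha> y"
  obtain K where K: "K \<in> \<pi>" "x \<in> K"
    using p by (metis UNIV_I UnionE partition_onD1)
  show "\<exists>K\<in>\<pi>. x \<in> K \<and> y \<in> K"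
  proof (rule ccontr)
    assume "\<not> ?thesis"
    then have y: "y \<notin> K" using K by auto
    define \<alpha> where "\<alpha> z = (if z \<in> K then x else y)" for z
    have "\<alpha> \<in> bar \<pi>"
      unfolding bar_def
    proof (clarify)
      fix L u v assume L: "L \<in> \<pi>" "u \<in> L" "v \<in> L"
      show "\<alpha> u = \<alpha> v"
      proof (cases "L = K")
        case True then show ?thesis using L by (simp add: \<alpha>_def)
      next
        case False
        then have "L \<inter> K = {}" using p L K by (metis disjointD partition_onD2)
        then show ?thesis using L by (auto simp: \<alpha>_def)
      qed
    qed
    then have "\<alpha> x = \<alpha> y" using all by blast
    then show False using K y by (auto simp: \<alpha>_def)
  qed
qed

lemma partition_eq_classes:
  assumes "partition_on UNIV \<pi>"
  shows "\<pi> = {{y. \<exists>K\<in>\<pi>. x \<in> K \<and> y \<in> K} | x. True}"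
proof -
  have cls: "{y. \<exists>L\<in>\<pi>. x \<in> L \<and> y \<in> L} = K" if "K \<in> \<pi>" "x \<in> K" for K x
    using that same_class[OF assms] by blast
  show ?thesis
  proof (intro equalityI subsetI)
    fix K assume K: "K \<in> \<pi>"
    then obtain x where "x \<in> K" using assms by (metis ex_in_conv partition_onD3)
    then show "K \<in> {{y. \<exists>K\<in>\<pi>. x \<in> K \<and> y \<in> K} | x. True}" using cls K by blast
  next
    fix K assume "K \<in> {{y. \<exists>K\<in>\<pi>. x \<in> K \<and> y \<in> K} | x. True}"
    then obtain x where x: "K = {y. \<exists>K\<in>\<pi>. x \<in> K \<and> y \<in> K}" by blast
    obtain L where "L \<in> \<pi>" "x \<in> L"
      using assms by (metis UNIV_I UnionE partition_onD1)
    then show "K \<in> \<pi>" using cls x by simp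
  qed
qed

lemma bar_inject:
  assumes "partition_on UNIV \<pi>1" "partition_on UNIV \<pi>2" "bar \<pi>1 = bar \<pi>2"
  shows "\<pi>1 = \<pi>2"
  using partition_eq_classes[OF assms(1)] partition_eq_classes[OF assms(2)]
  unfolding bar_same_class_iff[OF assms(1)] bar_same_class_iff[OF assms(2)] assms(3) by simp

lemma partition_of_bar: "partition_on UNIV \<pi> \<Longrightarrow> partition_of (bar \<pi>) = \<pi>"
  unfolding partition_of_def by (rule the_equality) (use bar_inject in blast)+

lemma star_map_apply:
  assumes "partition_on UNIV \<pi>1" "partition_on UNIV \<pi>2" "\<eta> \<in> \<pi>2 \<rightarrow> \<pi>1"
    and "\<alpha> \<in> bar \<pi>1" "K \<in> \<pi>2" "x \<in> K" "y \<in> \<eta> K"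
  shows "star_map \<pi>1 \<pi>2 \<eta> \<alpha> x = \<alpha> y"
proof -
  have "class_of \<pi>2 x = K"
    unfolding class_of_def using assms(2,5,6)
    by (intro the_equality) (auto dest: same_class[OF assms(2)])
  moreover have "\<alpha> ` \<eta> K = {\<alpha> y}"
    using assms(3,4,5,7) by (fastforce simp: bar_def)
  ultimately show ?thesis using assms(4) by (simp add: star_map_def)
qed

text \<open>The elements of \<open>Gamma \<theta> A V\<close> are exactly the \<open>\<theta>a\<close>, and \<open>\<theta>a\<close> determines \<open>a\<close>.\<close>

lemma Gamma_eq:
  assumes "V \<in> Ob (Pi_category \<theta>)"
  shows "Gamma \<theta> A V = {\<theta> \<circ>> a | a. range a \<subseteq> A \<and> bar (fibres a) \<subseteq> V}"
proof -
  obtain \<pi> where p: "partition_on UNIV \<pi>" and s: "saturates (range \<theta>) \<pi>" and V: "V = bar \<pi>"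
    using assms by (auto simp: Pi_category_def set_category_def)
  have cover: "\<exists>K\<in>\<pi>. x \<in> K" for x using p by (metis UNIV_I UnionE partition_onD1)
  show ?thesis
  proof (intro equalityI subsetI)
    fix b assume "b \<in> Gamma \<theta> A V"
    then have b: "range b \<subseteq> A" "b \<in> bar {\<theta> -` K | K. K \<in> \<pi>}"
      by (auto simp: Gamma_def theta_star_def V partition_of_bar[OF p] bar_fibres_subset_iff)
    have "\<exists>z. \<exists>K\<in>\<pi>. x \<in> K \<and> \<theta> z \<in> K" for x
    proof -
      obtain K where "K \<in> \<pi>" "x \<in> K" using cover by blast
      moreover then obtain z where "\<theta> z \<in> K" using s by (fastforce simp: saturates_def)
      ultimately show ?thesis by blast
    qed
    then obtain z where z: "\<And>x. \<exists>K\<in>\<pi>. x \<in> K \<and> \<theta> (z x) \<in> K" by metis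
    define a where "a x = b (z x)" for x
    have key: "b u = b v" if "K \<in> \<pi>" "\<theta> u \<in> K" "\<theta> v \<in> K" for u v K
      using b(2) that unfolding bar_def by blast
    have same: "K = L" if "K \<in> \<pi>" "L \<in> \<pi>" "x \<in> K" "x \<in> L" for K L x
      using same_class[OF p] that by blast
    have "b = \<theta> \<circ>> a"
    proof
      fix x
      obtain K where "K \<in> \<pi>" "\<theta> x \<in> K" "\<theta> (z (\<theta> x)) \<in> K" using z by blast
      then have "b x = b (z (\<theta> x))" by (rule key)
      then show "b x = (\<theta> \<circ>> a) x" by (simp add: a_def fcomp_def)
    qed
    moreover have "a \<in> bar \<pi>"
      unfolding bar_def
    proof clarify
      fix K x y assume K: "K \<in> \<pi>" "x \<in> K" "y \<in> K"
      have "\<theta> (z x) \<in> K" "\<theta> (z y) \<in> K" using z same K by metis+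
      then have "b (z x) = b (z y)" by (rule key[OF K(1)])
      then show "a x = a y" by (simp add: a_def)
    qed
    moreover have "range a \<subseteq> A" using b(1) by (auto simp: a_def)
    ultimately show "b \<in> {\<theta> \<circ>> a | a. range a \<subseteq> A \<and> bar (fibres a) \<subseteq> V}"
      using V bar_fibres_subset_iff by blast
  next
    fix b assume "b \<in> {\<theta> \<circ>> a | a. range a \<subseteq> A \<and> bar (fibres a) \<subseteq> V}"
    then obtain a where a: "b = \<theta> \<circ>> a" "range a \<subseteq> A" "a \<in> bar \<pi>"
      using V bar_fibres_subset_iff by blast
    have "b \<in> bar {\<theta> -` K | K. K \<in> \<pi>}"
      using a(3) by (auto simp: a(1) bar_def fcomp_def)
    then show "b \<in> Gamma \<theta> A V"
      using a by (auto simp: Gamma_def theta_star_def V partition_of_bar[OF p] bar_fibres_subset_iff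
          fcomp_def)
  qed
qed

lemma theta_comp_inject:
  assumes "V \<in> Ob (Pi_category \<theta>)" "bar (fibres a) \<subseteq> V" "bar (fibres b) \<subseteq> V"
    and eq: "\<theta> \<circ>> a = \<theta> \<circ>> b"
  shows "a = b"
proof
  fix x
  obtain \<pi> where p: "partition_on UNIV \<pi>" and s: "saturates (range \<theta>) \<pi>" and V: "V = bar \<pi>"
    using assms by (auto simp: Pi_category_def set_category_def)
  obtain K where K: "K \<in> \<pi>" "x \<in> K" using p by (metis UNIV_I UnionE partition_onD1)
  then obtain z where z: "\<theta> z \<in> K" using s by (fastforce simp: saturates_def)
  have "a \<in> bar \<pi>" "b \<in> bar \<pi>" using assms V bar_fibres_subset_iff by blast+
  then have "a x = a (\<theta> z)" "b x = b (\<theta> z)" using K z unfolding bar_def by blast+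
  moreover have "a (\<theta> z) = b (\<theta> z)" using eq by (simp add: fcomp_def fun_eq_iff)
  ultimately show "a x = b x" by simp
qed

lemma chi_eq:
  assumes "V \<in> Ob (Pi_category \<theta>)" "range a \<subseteq> A" "bar (fibres a) \<subseteq> V"
  shows "chi \<theta> A V (\<theta> \<circ>> a) = a \<circ>> \<theta>"
  unfolding chi_def using assms theta_comp_inject[OF assms(1)] by (intro the_equality) blast+

lemma chi_bij:
  assumes A: "A \<in> Ob (P_category \<theta>)" and V: "V \<in> Ob (Pi_category \<theta>)"
  shows "bij_betw (chi \<theta> A V) (Gamma \<theta> A V) (Delta \<theta> A V)"
proof -
  obtain \<pi> where Vp: "V = bar \<pi>" using V by (auto simp: Pi_category_def set_category_def)
  have inj: "x = y" if "x \<in> A" "y \<in> A" "\<theta> x = \<theta> y" for x y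
  proof -
    have "separates (fibres \<theta>) A" using A by (simp add: P_category_def set_category_def)
    moreover have "\<theta> -` {\<theta> x} \<in> fibres \<theta>" by (auto simp: fibres_def)
    ultimately show ?thesis using that unfolding separates_def by fastforce
  qed
  show ?thesis
  proof (rule bij_betw_imageI)
    show "inj_on (chi \<theta> A V) (Gamma \<theta> A V)"
    proof (rule inj_onI)
      fix g h assume "g \<in> Gamma \<theta> A V" "h \<in> Gamma \<theta> A V" and eq: "chi \<theta> A V g = chi \<theta> A V h"
      then obtain a b where a: "g = \<theta> \<circ>> a" "range a \<subseteq> A" "bar (fibres a) \<subseteq> V"
        and b: "h = \<theta> \<circ>> b" "range b \<subseteq> A" "bar (fibres b) \<subseteq> V"
        unfolding Gamma_eq[OF V] by blast
      have "a \<circ>> \<theta> = b \<circ>> \<theta>" using eq a b chi_eq[OF V] by simp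
      then have "\<theta> (a x) = \<theta> (b x)" for x by (simp add: fcomp_def fun_eq_iff)
      then have "a = b" using inj a(2) b(2) by (metis ext rangeI subsetD)
      then show "g = h" using a b by simp
    qed
    show "chi \<theta> A V ` Gamma \<theta> A V = Delta \<theta> A V"
    proof (intro equalityI subsetI)
      fix d assume "d \<in> chi \<theta> A V ` Gamma \<theta> A V"
      then obtain a where a: "d = a \<circ>> \<theta>" "range a \<subseteq> A" "bar (fibres a) \<subseteq> V"
        unfolding Gamma_eq[OF V] using chi_eq[OF V] by auto
      then have "a \<in> bar \<pi>" using Vp bar_fibres_subset_iff by blast
      then have "d \<in> bar \<pi>" unfolding a(1) bar_def fcomp_def by fastforce
      then show "d \<in> Delta \<theta> A V"
        using a(1,2) by (auto simp: Delta_def Vp bar_fibres_subset_iff fcomp_def)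
    next
      fix d assume d: "d \<in> Delta \<theta> A V"
      then have "\<forall>x. \<exists>y\<in>A. d x = \<theta> y" by (auto simp: Delta_def)
      then obtain a where a: "\<And>x. a x \<in> A" "\<And>x. d x = \<theta> (a x)" by metis
      have "d \<in> bar \<pi>" using d by (auto simp: Delta_def Vp bar_fibres_subset_iff)
      then have "a \<in> bar \<pi>" using a inj unfolding bar_def mem_Collect_eq by metis
      then have V': "bar (fibres a) \<subseteq> V" using Vp bar_fibres_subset_iff by blast
      have "range a \<subseteq> A" using a by auto
      then have "chi \<theta> A V (\<theta> \<circ>> a) = a \<circ>> \<theta>" "\<theta> \<circ>> a \<in> Gamma \<theta> A V"
        using chi_eq[OF V _ V'] Gamma_eq[OF V] V' by blast+
      moreover have "d = a \<circ>> \<theta>" using a by (simp add: fcomp_def fun_eq_iff)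
      ultimately show "d \<in> chi \<theta> A V ` Gamma \<theta> A V" by (metis imageI)
    qed
  qed
qed

lemma variant_regular_iff:
  "a \<in> elems (regular_part (variant \<theta>)) \<longleftrightarrow>
     separates (fibres \<theta>) (range a) \<and> saturates (range \<theta>) (fibres a)"
proof
  assume "a \<in> elems (regular_part (variant \<theta>))"
  then obtain c where "a \<circ>> \<theta> \<circ>> c \<circ>> \<theta> \<circ>> a = a"
    by (auto simp: regular_part_def variant_def)
  then have c: "a (\<theta> (c (\<theta> (a x)))) = a x" for x by (simp add: fcomp_def fun_eq_iff)
  have "separates (fibres \<theta>) (range a)"
    unfolding separates_def fibres_def by (auto simp: vimage_def) (metis c)
  moreover have "saturates (range \<theta>) (fibres a)"
    unfolding saturates_def fibres_def using c by blast
  ultimately show "separates (fibres \<theta>) (range a) \<and> saturates (range \<theta>) (fibres a)" by simp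
next
  assume as: "separates (fibres \<theta>) (range a) \<and> saturates (range \<theta>) (fibres a)"
  have inj: "a x = a y" if "\<theta> (a x) = \<theta> (a y)" for x y
  proof -
    have "\<theta> -` {\<theta> (a x)} \<in> fibres \<theta>" by (auto simp: fibres_def)
    moreover have "a x \<in> \<theta> -` {\<theta> (a x)} \<inter> range a" "a y \<in> \<theta> -` {\<theta> (a x)} \<inter> range a"
      using that by auto
    ultimately show ?thesis using as unfolding separates_def by blast
  qed
  have "\<exists>z. a (\<theta> z) = a x" for x
  proof -
    have "a -` {a x} \<in> fibres a" by (auto simp: fibres_def)
    then have "a -` {a x} \<inter> range \<theta> \<noteq> {}" using as unfolding saturates_def by blast
    then show ?thesis by auto
  qed
  then obtain z where z: "\<And>x. a (\<theta> (z x)) = a x" by metis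
  define c where "c y = z (SOME x. \<theta> (a x) = y)" for y
  have "a (\<theta> (c (\<theta> (a x)))) = a x" for x
  proof -
    have "\<theta> (a (SOME x'. \<theta> (a x') = \<theta> (a x))) = \<theta> (a x)"
      by (rule someI[of "\<lambda>x'. \<theta> (a x') = \<theta> (a x)" x]) simp
    then have "a (SOME x'. \<theta> (a x') = \<theta> (a x)) = a x" by (rule inj)
    then show ?thesis unfolding c_def z .
  qed
  then have "a \<circ>> \<theta> \<circ>> c \<circ>> \<theta> \<circ>> a = a" by (simp add: fcomp_def fun_eq_iff)
  then show "a \<in> elems (regular_part (variant \<theta>))"
    by (auto simp: regular_part_def variant_def fcomp_assoc)
qed

lemma partition_fibres: "partition_on UNIV (fibres a)"
  by (auto simp: partition_on_def fibres_def disjoint_def)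

lemma cross_connection_semigroup_elems:
  "elems (cross_connection_semigroup \<theta>) =
     {(\<theta> \<circ>> a, a \<circ>> \<theta>) | a. a \<in> elems (regular_part (variant \<theta>))}"
proof (intro equalityI subsetI)
  fix p assume "p \<in> elems (cross_connection_semigroup \<theta>)"
  then obtain A V g where A: "A \<in> Ob (P_category \<theta>)" and V: "V \<in> Ob (Pi_category \<theta>)"
    and g: "g \<in> Gamma \<theta> A V" and p: "p = (g, chi \<theta> A V g)"
    by (auto simp: cross_connection_semigroup_def linked_def)
  obtain a where a: "g = \<theta> \<circ>> a" "range a \<subseteq> A" "bar (fibres a) \<subseteq> V"
    using g unfolding Gamma_eq[OF V] by blast
  obtain \<pi> where pi: "partition_on UNIV \<pi>" and s: "saturates (range \<theta>) \<pi>" and Vp: "V = bar \<pi>"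
    using V by (auto simp: Pi_category_def set_category_def)
  have abar: "a \<in> bar \<pi>" using a Vp bar_fibres_subset_iff by blast
  have "separates (fibres \<theta>) (range a)"
    using A a(2) by (auto simp: P_category_def set_category_def separates_def) (meson IntI rangeI subsetD)
  moreover have "K \<inter> range \<theta> \<noteq> {}" if K: "K \<in> fibres a" for K
  proof -
    obtain y where "K = a -` {y}" "y \<in> range a" using K unfolding fibres_def by blast
    then obtain x where x: "K = a -` {a x}" by blast
    obtain L where L: "L \<in> \<pi>" "x \<in> L" using pi by (metis UNIV_I UnionE partition_onD1)
    then obtain z where "\<theta> z \<in> L" using s by (fastforce simp: saturates_def)
    then have "a (\<theta> z) = a x" using abar L unfolding bar_def by blast
    then show ?thesis using x by auto
  qed
  ultimately have "a \<in> elems (regular_part (variant \<theta>))"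
    unfolding variant_regular_iff saturates_def by blast
  then show "p \<in> {(\<theta> \<circ>> a, a \<circ>> \<theta>) | a. a \<in> elems (regular_part (variant \<theta>))}"
    using p a chi_eq[OF V a(2,3)] by blast
next
  fix p assume "p \<in> {(\<theta> \<circ>> a, a \<circ>> \<theta>) | a. a \<in> elems (regular_part (variant \<theta>))}"
  then obtain a where p: "p = (\<theta> \<circ>> a, a \<circ>> \<theta>)"
    and a: "separates (fibres \<theta>) (range a)" "saturates (range \<theta>) (fibres a)"
    unfolding variant_regular_iff by blast
  have A: "range a \<in> Ob (P_category \<theta>)" using a by (auto simp: P_category_def set_category_def)
  have V: "bar (fibres a) \<in> Ob (Pi_category \<theta>)"
    using a partition_fibres by (auto simp: Pi_category_def set_category_def)
  have "linked \<theta> (\<theta> \<circ>> a) (a \<circ>> \<theta>)"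
    unfolding linked_def using A V chi_eq[OF V, of a "range a"] Gamma_eq[OF V, of "range a"]
    by (intro bexI[OF _ A] bexI[OF _ V]) auto
  then show "p \<in> elems (cross_connection_semigroup \<theta>)"
    using p by (simp add: cross_connection_semigroup_def)
qed

end

theory Submission
  imports Defs
begin

text \<open>
  A regular element of the variant is a map \<open>a\<close> such that \<open>\<theta>\<close> is injective on the image of \<open>a\<close> and
  every value of \<open>a\<close> is attained on the image of \<open>\<theta>\<close>. Such an \<open>a\<close> is recovered from
  \<open>(\<theta>a, a\<theta>)\<close>, because two regular elements with the same pair have the same image and \<open>\<theta>\<close> is
  injective on it. For an idempotent \<open>e\<close>, the left ideal of \<open>e\<close> consists of the regular elements
  with image in that of \<open>e\<close>, and right multiplication by \<open>u\<close> acts on it as composition with the map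
  \<open>\<theta>u\<close> on the image of \<open>e\<close>. The right ideal of \<open>e\<close> consists of the regular elements that are constant
  on the fibres of \<open>e\<close>, and left multiplication by \<open>w\<close> acts on it as precomposition with \<open>w\<theta>\<close>;
  the morphisms of \<open>Pi_category \<theta>\<close> are exactly the precompositions that respect the two partitions.
\<close>

section \<open>Isomorphisms of categories\<close>

text \<open>The isomorphism is given by data \<open>G0\<close>, \<open>G1\<close> out of
  \<open>D\<close>, bijective on objects and on each hom-set. The category laws of \<open>C\<close>
  are then carried over from \<open>D\<close>, so for the ideal categories, whose hom-sets are
  awkward to handle directly, they never have to be checked by hand.\<close>

lemma cat_isomorphicI:
  assumes D: "is_category D"
    and G0: "bij_betw G0 (Ob D) (Ob C)"
    and G1: "\<And>A B. A \<in> Ob D \<Longrightarrow> B \<in> Ob D \<Longrightarrow> bij_betw (G1 A B) (Hom D A B) (Hom C (G0 A) (G0 B))"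
    and Id: "\<And>A. A \<in> Ob D \<Longrightarrow> G1 A A (Ident D A) = Ident C (G0 A)"
    and Cp: "\<And>A B E f g. A \<in> Ob D \<Longrightarrow> B \<in> Ob D \<Longrightarrow> E \<in> Ob D \<Longrightarrow> f \<in> Hom D A B \<Longrightarrow> g \<in> Hom D B E \<Longrightarrow>
       G1 A E (Comp D A B E f g) = Comp C (G0 A) (G0 B) (G0 E) (G1 A B f) (G1 B E g)"
  shows "cat_isomorphic C D"
proof -
  have obC: "\<exists>A'\<in>Ob D. A = G0 A'" if "A \<in> Ob C" for A
    using that G0 by (auto simp: bij_betw_def)
  have homC: "\<exists>f'\<in>Hom D A B. f = G1 A B f'" if "A \<in> Ob D" "B \<in> Ob D" "f \<in> Hom C (G0 A) (G0 B)" for A B f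
    using that G1[OF that(1,2)] by (auto simp: bij_betw_def)
  have G0m: "G0 A \<in> Ob C" if "A \<in> Ob D" for A using that G0 by (auto simp: bij_betw_def)
  have G1m: "G1 A B f \<in> Hom C (G0 A) (G0 B)" if "A \<in> Ob D" "B \<in> Ob D" "f \<in> Hom D A B" for A B f
    using that G1[OF that(1,2)] by (auto simp: bij_betw_def)
  have DId: "Ident D A \<in> Hom D A A" if "A \<in> Ob D" for A
    using D that by (auto simp: is_category_def)
  have DCp: "Comp D A B E f g \<in> Hom D A E"
    if "A \<in> Ob D" "B \<in> Ob D" "E \<in> Ob D" "f \<in> Hom D A B" "g \<in> Hom D B E" for A B E f g
    using D that unfolding is_category_def by blast
  have Dunit: "Comp D A A B (Ident D A) f = f" "Comp D A B B f (Ident D B) = f"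
    if "A \<in> Ob D" "B \<in> Ob D" "f \<in> Hom D A B" for A B f
    using D that unfolding is_category_def by blast+
  have Dassoc: "Comp D A B' E (Comp D A B B' f g) h = Comp D A B E f (Comp D B B' E g h)"
    if "A \<in> Ob D" "B \<in> Ob D" "B' \<in> Ob D" "E \<in> Ob D"
      "f \<in> Hom D A B" "g \<in> Hom D B B'" "h \<in> Hom D B' E" for A B B' E f g h
    using D that unfolding is_category_def by blast
  have C: "is_category C"
    unfolding is_category_def
  proof (intro conjI ballI)
    fix A assume "A \<in> Ob C"
    then show "Ident C A \<in> Hom C A A" using obC Id G1m DId by metis
  next
    fix A B E f g
    assume *: "A \<in> Ob C" "B \<in> Ob C" "E \<in> Ob C" "f \<in> Hom C A B" "g \<in> Hom C B E"
    obtain A' B' E' where o: "A' \<in> Ob D" "A = G0 A'" "B' \<in> Ob D" "B = G0 B'" "E' \<in> Ob D" "E = G0 E'"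
      using *(1-3)[THEN obC] by blast
    obtain f' g' where "f' \<in> Hom D A' B'" "f = G1 A' B' f'" "g' \<in> Hom D B' E'" "g = G1 B' E' g'"
      using homC *(4,5) o by blast
    then show "Comp C A B E f g \<in> Hom C A E" by (simp add: o Cp[symmetric] DCp G1m)
  next
    fix A B f
    assume *: "A \<in> Ob C" "B \<in> Ob C" "f \<in> Hom C A B"
    obtain A' B' where o: "A' \<in> Ob D" "A = G0 A'" "B' \<in> Ob D" "B = G0 B'"
      using *(1,2)[THEN obC] by blast
    obtain f' where f: "f' \<in> Hom D A' B'" "f = G1 A' B' f'"
      using homC *(3) o by blast
    show "Comp C A A B (Ident C A) f = f" "Comp C A B B f (Ident C B) = f"
      unfolding o(2,4) f(2) using Cp[OF o(1,1,3) DId[OF o(1)] f(1)] Cp[OF o(1,3,3) f(1) DId[OF o(3)]]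
      by (simp_all add: Id o(1,3) Dunit[OF o(1,3) f(1)])
  next
    fix A B E F f g h
    assume *: "A \<in> Ob C" "B \<in> Ob C" "E \<in> Ob C" "F \<in> Ob C"
      "f \<in> Hom C A B" "g \<in> Hom C B E" "h \<in> Hom C E F"
    obtain A' B' E' F' where o: "A' \<in> Ob D" "B' \<in> Ob D" "E' \<in> Ob D" "F' \<in> Ob D"
      and o': "A = G0 A'" "B = G0 B'" "E = G0 E'" "F = G0 F'"
      using *(1-4)[THEN obC] by blast
    obtain f' g' h' where f: "f' \<in> Hom D A' B'" "g' \<in> Hom D B' E'" "h' \<in> Hom D E' F'"
      and f': "f = G1 A' B' f'" "g = G1 B' E' g'" "h = G1 E' F' h'"
      using homC[OF o(1,2)] homC[OF o(2,3)] homC[OF o(3,4)] *(5-7) unfolding o' by blast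
    show "Comp C A E F (Comp C A B E f g) h = Comp C A B F f (Comp C B E F g h)"
      unfolding o' f' using o f by (simp add: Cp[symmetric] DCp Dassoc)
  qed
  define F0 where "F0 = inv_into (Ob D) G0"
  define F1 where "F1 A B = inv_into (Hom D (F0 A) (F0 B)) (G1 (F0 A) (F0 B))" for A B
  have F0G0: "F0 (G0 A) = A" if "A \<in> Ob D" for A
    using G0 that by (simp add: F0_def bij_betw_def)
  have G0F0: "G0 (F0 A) = A" and F0m: "F0 A \<in> Ob D" if "A \<in> Ob C" for A
    using obC[OF that] F0G0 by auto
  have F1G1: "F1 (G0 A) (G0 B) (G1 A B f) = f" if "A \<in> Ob D" "B \<in> Ob D" "f \<in> Hom D A B" for A B f
    using G1[OF that(1,2)] that by (simp add: F1_def F0G0 bij_betw_def)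
  have G1F1: "G1 (F0 A) (F0 B) (F1 A B f) = f" and F1m: "F1 A B f \<in> Hom D (F0 A) (F0 B)"
    if "A \<in> Ob C" "B \<in> Ob C" "f \<in> Hom C A B" for A B f
    using homC[of "F0 A" "F0 B" f] F1G1[of "F0 A" "F0 B"] that F0m G0F0 by auto
  have GF: "is_functor D C G0 G1"
    unfolding is_functor_def using C D G0m G1m Id Cp by simp
  have FG: "is_functor C D F0 F1"
    unfolding is_functor_def
  proof (intro conjI ballI)
    fix A assume A: "A \<in> Ob C"
    show "F0 A \<in> Ob D" using F0m A .
    show "F1 A A (Ident C A) = Ident D (F0 A)"
      using F1G1[of "F0 A" "F0 A" "Ident D (F0 A)"] A F0m G0F0 Id DId by simp
  next
    fix A B E f g
    assume *: "A \<in> Ob C" "B \<in> Ob C" "E \<in> Ob C" "f \<in> Hom C A B" "g \<in> Hom C B E"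
    show "F1 A E (Comp C A B E f g) = Comp D (F0 A) (F0 B) (F0 E) (F1 A B f) (F1 B E g)"
      \<comment> \<open>\<open>G1\<close> sends this composite in \<open>D\<close> to
        \<open>Comp C A B E f g\<close>, and cancelling \<open>G1\<close> gives functoriality of the
        inverse.\<close>
      using F1G1[of "F0 A" "F0 E" "Comp D (F0 A) (F0 B) (F0 E) (F1 A B f) (F1 B E g)"]
      by (simp add: * F0m G0F0 Cp DCp F1m G1F1)
  qed (use C D F1m in auto)
  show ?thesis
    unfolding cat_isomorphic_def
    by (rule exI[of _ F0], rule exI[of _ F1], rule exI[of _ G0], rule exI[of _ G1])
      (use FG GF F0G0 G0F0 F1G1 G1F1 in \<open>intro conjI ballI; simp\<close>)
qed

lemma is_category_set_category:
  assumes "\<And>A B. A \<in> Obs \<Longrightarrow> B \<in> Obs \<Longrightarrow> Homs A B \<subseteq> A \<rightarrow>\<^sub>E B"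
    and "\<And>A. A \<in> Obs \<Longrightarrow> (\<lambda>x\<in>A. x) \<in> Homs A A"
    and "\<And>A B D f g. A \<in> Obs \<Longrightarrow> B \<in> Obs \<Longrightarrow> D \<in> Obs \<Longrightarrow> f \<in> Homs A B \<Longrightarrow> g \<in> Homs B D \<Longrightarrow>
       compose A g f \<in> Homs A D"
  shows "is_category (set_category Obs Homs)"
proof -
  have ext: "f \<in> A \<rightarrow>\<^sub>E B" if "A \<in> Obs" "B \<in> Obs" "f \<in> Homs A B" for A B f
    using assms(1) that by blast
  have "compose A f (\<lambda>x\<in>A. x) = f" "compose A (\<lambda>x\<in>B. x) f = f"
    if "A \<in> Obs" "B \<in> Obs" "f \<in> Homs A B" for A B f
    using ext[OF that] by (auto simp: PiE_def intro: compose_Id Id_compose)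
  moreover have "compose A h (compose A g f) = compose A (compose B h g) f"
    if "A \<in> Obs" "B \<in> Obs" "f \<in> Homs A B" for A B f g h
    using ext[OF that] by (intro compose_assoc) (auto simp: PiE_def)
  ultimately show ?thesis
    unfolding is_category_def set_category_def cat.simps using assms(2,3)
    by (intro conjI ballI) simp_all
qed


section \<open>Regular and idempotent elements of the variant\<close>

lemma mul_variant: "mul (regular_part (variant \<theta>)) a b = (\<lambda>x. b (\<theta> (a x)))"
  by (simp add: regular_part_def variant_def fcomp_def fun_eq_iff)

lemma fibres_eq: "fibres a = range (\<lambda>x. a -` {a x})"
  by (auto simp: fibres_def)

lemma separates_fibres_iff: "separates (fibres \<theta>) A \<longleftrightarrow> inj_on \<theta> A"
  by (auto simp: separates_def fibres_eq inj_on_def)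

lemma saturates_fibres_iff: "saturates (range \<theta>) (fibres a) \<longleftrightarrow> (\<forall>x. \<exists>z. a (\<theta> z) = a x)"
  unfolding saturates_def fibres_eq by blast

lemma regular_iff:
  "a \<in> elems (regular_part (variant \<theta>)) \<longleftrightarrow> inj_on \<theta> (range a) \<and> (\<forall>x. \<exists>z. a (\<theta> z) = a x)"
  unfolding variant_regular_iff separates_fibres_iff saturates_fibres_iff ..

text \<open>The image of the product lies in the image of the right factor, which gives injectivity
  of \<theta>; its values are attained on the image of \<theta> because those of the left factor
  are.\<close>

lemma regular_mul:
  assumes "a \<in> elems (regular_part (variant \<theta>))" "b \<in> elems (regular_part (variant \<theta>))"
  shows "(\<lambda>x. b (\<theta> (a x))) \<in> elems (regular_part (variant \<theta>))"
  unfolding regular_iff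
proof
  show "inj_on \<theta> (range (\<lambda>x. b (\<theta> (a x))))"
    by (rule inj_on_subset[of \<theta> "range b"]) (use assms(2) in \<open>auto simp: regular_iff\<close>)
  show "\<forall>x. \<exists>z. b (\<theta> (a (\<theta> z))) = b (\<theta> (a x))"
    using assms(1) unfolding regular_iff by metis
qed

lemma is_semigroup_regular_part_variant: "is_semigroup (regular_part (variant \<theta>))"
  by (simp add: is_semigroup_def mul_variant regular_mul)

text \<open>The equation itself forces regularity: \<open>e x\<close> is the value of
  \<open>e\<close> at \<open>\<theta> (e x)\<close>, so it is attained on the image of \<theta> and
  is determined by \<open>\<theta> (e x)\<close>.\<close>

lemma idempotent_iff:
  "e \<in> idempotents (regular_part (variant \<theta>)) \<longleftrightarrow> (\<forall>x. e (\<theta> (e x)) = e x)"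
proof
  assume "\<forall>x. e (\<theta> (e x)) = e x"
  then show "e \<in> idempotents (regular_part (variant \<theta>))"
    unfolding idempotents_def mem_Collect_eq mul_variant regular_iff inj_on_def fun_eq_iff ball_simps
    by metis
qed (simp add: idempotents_def mul_variant fun_eq_iff)

lemma idempotent_regular:
  "e \<in> idempotents S \<Longrightarrow> e \<in> elems S"
  by (simp add: idempotents_def)

lemma idempotent_range:
  assumes "e \<in> idempotents (regular_part (variant \<theta>))" "y \<in> range e"
  shows "e (\<theta> y) = y"
  using assms by (auto simp: idempotent_iff)

section \<open>Principal ideals and sandwich sets of idempotents\<close>

lemma bar_fibres_iff: "a \<in> bar (fibres e) \<longleftrightarrow> (\<forall>x y. e x = e y \<longrightarrow> a x = a y)"
proof
  assume a: "a \<in> bar (fibres e)"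
  have "a x = a y" if "e x = e y" for x y
  proof -
    have "e -` {e x} \<in> fibres e" "x \<in> e -` {e x}" "y \<in> e -` {e x}"
      using that by (auto simp: fibres_eq)
    then show ?thesis using a unfolding bar_def by blast
  qed
  then show "\<forall>x y. e x = e y \<longrightarrow> a x = a y" by blast
next
  assume a: "\<forall>x y. e x = e y \<longrightarrow> a x = a y"
  have "a x = a y" if "x \<in> e -` {e z}" "y \<in> e -` {e z}" for x y z
    using that by (intro a[rule_format]) simp
  then show "a \<in> bar (fibres e)" unfolding bar_def fibres_eq by blast
qed

text \<open>The map \<open>\<theta> \<circ> e\<close> sends each point to a representative of its
  own fibre of \<open>e\<close>. Being constant on these fibres therefore means absorbing
  \<open>e\<close> on the left in the variant.\<close>

lemma bar_fibres_idempotent_iff: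
  assumes "e \<in> idempotents (regular_part (variant \<theta>))"
  shows "a \<in> bar (fibres e) \<longleftrightarrow> (\<forall>x. a (\<theta> (e x)) = a x)"
  using assms unfolding bar_fibres_iff idempotent_iff by metis

text \<open>Constancy on the fibres of \<open>e\<close> supplies the other half of regularity: the
  value at \<open>x\<close> is also taken at \<open>\<theta> (e x)\<close>.\<close>

lemma regular_bar_fibres:
  assumes "e \<in> idempotents (regular_part (variant \<theta>))" "a \<in> bar (fibres e)" "inj_on \<theta> (range a)"
  shows "a \<in> elems (regular_part (variant \<theta>))"
  using assms unfolding bar_fibres_idempotent_iff[OF assms(1)] regular_iff by blast

text \<open>\<open>e\<close> undoes \<theta> on its own image, so an element with image there is
  unchanged by right multiplication with \<open>e\<close> and is its own witness for membership in
  the ideal.\<close>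

lemma left_ideal_idempotent:
  assumes "e \<in> idempotents (regular_part (variant \<theta>))"
  shows "left_ideal (regular_part (variant \<theta>)) e =
    {a \<in> elems (regular_part (variant \<theta>)). range a \<subseteq> range e}"
proof (intro equalityI subsetI)
  fix a assume "a \<in> {a \<in> elems (regular_part (variant \<theta>)). range a \<subseteq> range e}"
  then have "a \<in> elems (regular_part (variant \<theta>))" "a = (\<lambda>x. e (\<theta> (a x)))"
    by (auto intro!: ext idempotent_range[OF assms, symmetric])
  then show "a \<in> left_ideal (regular_part (variant \<theta>)) e"
    unfolding left_ideal_def mul_variant by (intro CollectI exI[of _ a] conjI)
next
  fix a assume "a \<in> left_ideal (regular_part (variant \<theta>)) e"
  then show "a \<in> {a \<in> elems (regular_part (variant \<theta>)). range a \<subseteq> range e}"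
    using regular_mul[OF _ idempotent_regular[OF assms]] by (auto simp: left_ideal_def mul_variant)
qed

lemma right_ideal_idempotent:
  assumes "e \<in> idempotents (regular_part (variant \<theta>))"
  shows "right_ideal (regular_part (variant \<theta>)) e =
    bar (fibres e) \<inter> elems (regular_part (variant \<theta>))"
proof (intro equalityI subsetI)
  fix a assume "a \<in> bar (fibres e) \<inter> elems (regular_part (variant \<theta>))"
  then have "a \<in> elems (regular_part (variant \<theta>))" "a = (\<lambda>x. a (\<theta> (e x)))"
    using bar_fibres_idempotent_iff[OF assms] by simp_all
  then show "a \<in> right_ideal (regular_part (variant \<theta>)) e"
    unfolding right_ideal_def mul_variant by (intro CollectI exI[of _ a] conjI)
next
  fix a assume "a \<in> right_ideal (regular_part (variant \<theta>)) e"
  then show "a \<in> bar (fibres e) \<inter> elems (regular_part (variant \<theta>))"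
    using regular_mul[OF idempotent_regular[OF assms]]
    by (auto simp: right_ideal_def mul_variant bar_fibres_iff)
qed

text \<open>The two conditions say that \<open>u\<close> absorbs \<open>e\<close> on the left and
  \<open>f\<close> on the right. They also make \<open>u\<close> regular: saturation comes from
  \<open>e\<close>, and injectivity of \<theta> on the image comes from \<open>f\<close>.\<close>

lemma sandwich_idempotents:
  assumes e: "e \<in> idempotents (regular_part (variant \<theta>))"
    and f: "f \<in> idempotents (regular_part (variant \<theta>))"
  shows "sandwich (regular_part (variant \<theta>)) e f = {u \<in> bar (fibres e). range u \<subseteq> range f}"
proof (intro equalityI subsetI)
  fix u assume "u \<in> sandwich (regular_part (variant \<theta>)) e f"
  then show "u \<in> {u \<in> bar (fibres e). range u \<subseteq> range f}"
    by (auto simp: sandwich_def mul_variant bar_fibres_iff)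
next
  fix u assume u: "u \<in> {u \<in> bar (fibres e). range u \<subseteq> range f}"
  then have "u \<in> elems (regular_part (variant \<theta>))"
    using regular_bar_fibres[OF e] idempotent_regular[OF f] inj_on_subset[of \<theta> "range f" "range u"]
    by (simp add: regular_iff)
  moreover have "u = (\<lambda>x. f (\<theta> (u (\<theta> (e x)))))"
    using u bar_fibres_idempotent_iff[OF e] by (auto intro!: ext idempotent_range[OF f, symmetric])
  ultimately show "u \<in> sandwich (regular_part (variant \<theta>)) e f"
    unfolding sandwich_def mul_variant by (intro CollectI exI[of _ u] conjI)
qed


section \<open>The semigroup isomorphism\<close>

lemma cross_connection_inject:
  assumes a: "a \<in> elems (regular_part (variant \<theta>))" and b: "b \<in> elems (regular_part (variant \<theta>))"
    and eq: "\<theta> \<circ>> a = \<theta> \<circ>> b" "a \<circ>> \<theta> = b \<circ>> \<theta>"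
  shows "a = b"
proof
  fix x
  have 1: "a (\<theta> z) = b (\<theta> z)" "\<theta> (a z) = \<theta> (b z)" for z
    using eq by (simp_all add: fcomp_def fun_eq_iff)
  \<comment> \<open>Moving \<open>x\<close> into the image of \<theta>, where \<open>a\<close> and
    \<open>b\<close> agree, puts \<open>b x\<close> into the image of \<open>a\<close>; there
    \<theta> is injective and cannot tell \<open>a x\<close> from \<open>b x\<close>.\<close>
  obtain z where "b (\<theta> z) = b x" using b unfolding regular_iff by blast
  then have "b x \<in> range a" using 1 by (metis rangeI)
  then show "a x = b x" using a 1 unfolding regular_iff inj_on_def by blast
qed

lemma semigroup_isomorphic_cross_connection:
  "semigroup_isomorphic (cross_connection_semigroup \<theta>) (regular_part (variant \<theta>))"
proof -
  let ?S = "regular_part (variant \<theta>)" and ?T = "cross_connection_semigroup \<theta>"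
  define \<psi> where "\<psi> a = (\<theta> \<circ>> a, a \<circ>> \<theta>)" for a
  have inj: "inj_on \<psi> (elems ?S)"
    using cross_connection_inject by (fastforce simp: inj_on_def \<psi>_def)
  have im: "elems ?T = \<psi> ` elems ?S"
    by (auto simp: cross_connection_semigroup_elems \<psi>_def)
  \<comment> \<open>The product \<open>a \<theta> b\<close> of the variant gives \<theta> followed
    by it in the first component and it followed by \<theta> in the second.\<close>
  have hom: "mul ?T (\<psi> a) (\<psi> b) = \<psi> (mul ?S a b)" for a b
    by (simp add: cross_connection_semigroup_def \<psi>_def mul_variant fcomp_def)
  have S: "mul ?S a b \<in> elems ?S" if "a \<in> elems ?S" "b \<in> elems ?S" for a b
    using that by (simp add: mul_variant regular_mul)
  \<comment> \<open>Every element of \<open>?T\<close> has the form \<open>\<psi> a\<close>, so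
    closure and associativity are carried over along \<open>\<psi>\<close>.\<close>
  have "is_semigroup ?T"
    by (simp add: is_semigroup_def im hom S) (simp add: mul_variant)
  moreover have "bij_betw (inv_into (elems ?S) \<psi>) (elems ?T) (elems ?S)"
    using inj by (simp add: im bij_betw_inv_into bij_betw_imageI)
  moreover have "inv_into (elems ?S) \<psi> (mul ?T p q) =
      mul ?S (inv_into (elems ?S) \<psi> p) (inv_into (elems ?S) \<psi> q)"
    if "p \<in> elems ?T" "q \<in> elems ?T" for p q
    using that inj by (auto simp: im hom S)
  ultimately show ?thesis
    unfolding semigroup_isomorphic_def using is_semigroup_regular_part_variant by blast
qed


section \<open>The category of principal left ideals\<close>

lemma Ob_P_category: "Ob (P_category \<theta>) = {range e | e. e \<in> idempotents (regular_part (variant \<theta>))}"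
proof (intro equalityI subsetI)
  fix A assume "A \<in> Ob (P_category \<theta>)"
  then obtain y where y: "y \<in> A" and inj: "inj_on \<theta> A"
    by (auto simp: P_category_def set_category_def separates_fibres_iff)
  define e where "e x = (if x \<in> \<theta> ` A then inv_into A \<theta> x else y)" for x
  have 1: "e (\<theta> z) = z" if "z \<in> A" for z using inj that by (simp add: e_def)
  have 2: "e x \<in> A" for x using y by (simp add: e_def inv_into_into)
  have "range e = A" using 1 2 by (auto simp: image_iff) metis
  moreover have "e \<in> idempotents (regular_part (variant \<theta>))" using 1 2 by (simp add: idempotent_iff)
  ultimately show "A \<in> {range e | e. e \<in> idempotents (regular_part (variant \<theta>))}" by blast
next
  fix A assume "A \<in> {range e | e. e \<in> idempotents (regular_part (variant \<theta>))}"
  then show "A \<in> Ob (P_category \<theta>)"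
    by (auto simp: P_category_def set_category_def separates_fibres_iff regular_iff
        dest!: idempotent_regular)
qed

lemma is_category_P_category: "is_category (P_category \<theta>)"
  unfolding P_category_def by (rule is_category_set_category) (auto simp: compose_def)

text \<open>Each idempotent lies in its own ideal, hence in the other one, so the two images contain
  each other.\<close>

lemma left_ideal_inject:
  assumes "e \<in> idempotents (regular_part (variant \<theta>))" "f \<in> idempotents (regular_part (variant \<theta>))"
    and "left_ideal (regular_part (variant \<theta>)) e = left_ideal (regular_part (variant \<theta>)) f"
  shows "range e = range f"
  using assms(3) idempotent_regular[OF assms(1)] idempotent_regular[OF assms(2)]
  unfolding assms(1,2)[THEN left_ideal_idempotent] by blast

text \<open>The morphism \<rho> given by \<open>u\<close> sends \<open>a\<close> to
  \<open>u \<circ> \<theta> \<circ> a\<close> and so depends only on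
  \<open>u \<circ> \<theta>\<close> on the image of \<open>e\<close>, which can be any map into the
  image of \<open>f\<close>.\<close>

lemma Hom_L_category:
  assumes e: "e \<in> idempotents (regular_part (variant \<theta>))"
    and f: "f \<in> idempotents (regular_part (variant \<theta>))"
  defines "L \<equiv> left_ideal (regular_part (variant \<theta>))"
  shows "Hom (L_category (regular_part (variant \<theta>))) (L e) (L f) =
    (\<lambda>g. \<lambda>a\<in>L e. g \<circ> a) ` (range e \<rightarrow>\<^sub>E range f)"
proof (intro equalityI subsetI)
  fix h assume "h \<in> Hom (L_category (regular_part (variant \<theta>))) (L e) (L f)"
  then obtain e' f' u where e': "e' \<in> idempotents (regular_part (variant \<theta>))" "L e = L e'"
    and f': "f' \<in> idempotents (regular_part (variant \<theta>))" "L f = L f'"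
    and u: "u \<in> sandwich (regular_part (variant \<theta>)) e' f'"
    and h: "h = (\<lambda>a\<in>L e. \<lambda>x. u (\<theta> (a x)))"
    by (auto simp: L_category_def set_category_def rho_map_def mul_variant L_def)
  \<comment> \<open>The hom-set ranges over all idempotents generating the two ideals; the image of
    such a generator is the same for each choice.\<close>
  have "range f = range f'" using f f' left_ideal_inject unfolding L_def by blast
  then have "range u \<subseteq> range f" using u sandwich_idempotents[OF e'(1) f'(1)] by simp
  then have "(\<lambda>y\<in>range e. u (\<theta> y)) \<in> range e \<rightarrow>\<^sub>E range f" by auto
  moreover have "h = (\<lambda>a\<in>L e. (\<lambda>y\<in>range e. u (\<theta> y)) \<circ> a)"
    unfolding h by (rule restrict_ext) (auto simp: L_def left_ideal_idempotent[OF e] fun_eq_iff)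
  ultimately show "h \<in> (\<lambda>g. \<lambda>a\<in>L e. g \<circ> a) ` (range e \<rightarrow>\<^sub>E range f)" by blast
next
  fix h assume "h \<in> (\<lambda>g. \<lambda>a\<in>L e. g \<circ> a) ` (range e \<rightarrow>\<^sub>E range f)"
  then obtain g where g: "g \<in> range e \<rightarrow>\<^sub>E range f" and h: "h = (\<lambda>a\<in>L e. g \<circ> a)" by blast
  \<comment> \<open>The multiplier \<open>g \<circ> e\<close> realises \<open>g\<close>, since
    \<theta> followed by \<open>e\<close> is the identity on the image of \<open>e\<close>.\<close>
  have "g \<circ> e \<in> sandwich (regular_part (variant \<theta>)) e f"
    unfolding sandwich_idempotents[OF e f] using g by (auto simp: bar_fibres_iff)
  moreover have "h = rho_map (regular_part (variant \<theta>)) e (g \<circ> e)"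
    unfolding h rho_map_def mul_variant L_def
  proof (rule restrict_ext)
    fix a assume "a \<in> left_ideal (regular_part (variant \<theta>)) e"
    then have "e (\<theta> (a x)) = a x" for x
      by (intro idempotent_range[OF e]) (auto simp: left_ideal_idempotent[OF e])
    then show "g \<circ> a = (\<lambda>x. (g \<circ> e) (\<theta> (a x)))" by (simp add: fun_eq_iff)
  qed
  ultimately show "h \<in> Hom (L_category (regular_part (variant \<theta>))) (L e) (L f)"
    using e f by (auto simp: L_category_def set_category_def L_def)
qed

lemma cat_isomorphic_L_category: "cat_isomorphic (L_category (regular_part (variant \<theta>))) (P_category \<theta>)"
proof -
  let ?S = "regular_part (variant \<theta>)"
  \<comment> \<open>The ideal is described through the subset \<open>A\<close> alone, so no
    generating idempotent has to be chosen.\<close>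
  define G0 where "G0 A = {a \<in> elems ?S. range a \<subseteq> A}" for A
  define G1 :: "'a set \<Rightarrow> 'a set \<Rightarrow> ('a \<Rightarrow> 'a) \<Rightarrow> ('a \<Rightarrow> 'a) \<Rightarrow> ('a \<Rightarrow> 'a)"
    where "G1 A B g = (\<lambda>a\<in>G0 A. g \<circ> a)" for A B g
  have obj: "\<exists>e. e \<in> idempotents ?S \<and> A = range e" if "A \<in> Ob (P_category \<theta>)" for A
    using that unfolding Ob_P_category by blast
  have G0: "G0 (range e) = left_ideal ?S e" if "e \<in> idempotents ?S" for e
    using left_ideal_idempotent[OF that] by (simp add: G0_def)
  have idem: "e \<in> G0 (range e)" if "e \<in> idempotents ?S" for e
    using idempotent_regular[OF that] by (simp add: G0_def)
  have HomP: "Hom (P_category \<theta>) A B = (A \<rightarrow>\<^sub>E B)" for A B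
    by (simp add: P_category_def set_category_def)
  show ?thesis
  proof (rule cat_isomorphicI[OF is_category_P_category, where ?G0.0 = G0 and ?G1.0 = G1])
    have "inj_on G0 (Ob (P_category \<theta>))"
    proof (rule inj_onI)
      fix A B assume "A \<in> Ob (P_category \<theta>)" "B \<in> Ob (P_category \<theta>)" "G0 A = G0 B"
      then show "A = B" using obj G0 left_ideal_inject by metis
    qed
    moreover have "G0 ` Ob (P_category \<theta>) = Ob (L_category ?S)"
      by (force simp: Ob_P_category L_category_def set_category_def G0)
    ultimately show "bij_betw G0 (Ob (P_category \<theta>)) (Ob (L_category ?S))" by (simp add: bij_betw_def)
  next
    fix A B assume "A \<in> Ob (P_category \<theta>)" "B \<in> Ob (P_category \<theta>)"
    then obtain e f where e: "e \<in> idempotents ?S" "A = range e" and f: "f \<in> idempotents ?S" "B = range f"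
      using obj by blast
    have "inj_on (G1 A B) (A \<rightarrow>\<^sub>E B)"
    proof (rule inj_onI)
      fix g h assume gh: "g \<in> A \<rightarrow>\<^sub>E B" "h \<in> A \<rightarrow>\<^sub>E B" and "G1 A B g = G1 A B h"
      \<comment> \<open>Evaluating at \<open>e\<close> separates the maps because the image of
        \<open>e\<close> is all of \<open>A\<close>.\<close>
      then have "G1 A B g e = G1 A B h e" by simp
      then have "g \<circ> e = h \<circ> e" using idem[OF e(1)] by (simp add: G1_def e(2))
      then have "g y = h y" if "y \<in> A" for y
        using that e(2) by (auto simp: fun_eq_iff)
      then show "g = h" using gh by (rule PiE_ext[rotated 2])
    qed
    moreover have "G1 A B ` (A \<rightarrow>\<^sub>E B) = Hom (L_category ?S) (G0 A) (G0 B)"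
      using Hom_L_category[OF e(1) f(1)] by (simp add: e(2) f(2) G0[OF e(1)] G0[OF f(1)] G1_def)
    ultimately show "bij_betw (G1 A B) (Hom (P_category \<theta>) A B) (Hom (L_category ?S) (G0 A) (G0 B))"
      by (simp add: bij_betw_def HomP)
  next
    fix A
    show "G1 A A (Ident (P_category \<theta>) A) = Ident (L_category ?S) (G0 A)"
      unfolding G1_def L_category_def P_category_def set_category_def cat.simps
      by (rule restrict_ext) (auto simp: G0_def fun_eq_iff)
  next
    fix A B E f g
    assume ob: "A \<in> Ob (P_category \<theta>)" "B \<in> Ob (P_category \<theta>)"
      and "f \<in> Hom (P_category \<theta>) A B"
    then have f: "f \<in> A \<rightarrow>\<^sub>E B" by (simp add: HomP)
    \<comment> \<open>The composite of the restricted maps agrees with composition only if the first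
      one lands in the domain of the second. Here injectivity of \<theta> comes from the object
      \<open>B\<close> and saturation from \<open>a\<close>.\<close>
    have "f \<circ> a \<in> G0 B" if "a \<in> G0 A" for a
    proof -
      have "inj_on \<theta> B" using ob by (simp add: P_category_def set_category_def separates_fibres_iff)
      moreover have "range (f \<circ> a) \<subseteq> B" using f that by (auto simp: G0_def)
      moreover have "\<exists>z. (f \<circ> a) (\<theta> z) = (f \<circ> a) x" for x
        using that by (auto simp: G0_def regular_iff) metis
      ultimately show ?thesis by (simp add: G0_def regular_iff inj_on_subset)
    qed
    moreover have "a x \<in> A" if "a \<in> G0 A" for a x using that by (auto simp: G0_def)
    ultimately show "G1 A E (Comp (P_category \<theta>) A B E f g) =
        Comp (L_category ?S) (G0 A) (G0 B) (G0 E) (G1 A B f) (G1 B E g)"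
      unfolding G1_def L_category_def P_category_def set_category_def cat.simps compose_def
      by (intro restrict_ext) (simp add: fun_eq_iff)
  qed
qed


section \<open>The category of principal right ideals\<close>

lemma class_of_eq: "partition_on UNIV \<pi> \<Longrightarrow> K \<in> \<pi> \<Longrightarrow> x \<in> K \<Longrightarrow> class_of \<pi> x = K"
  unfolding class_of_def by (rule the_equality) (auto dest: same_class)

lemma class_of_mem:
  assumes "partition_on UNIV \<pi>"
  shows "class_of \<pi> x \<in> \<pi>" "x \<in> class_of \<pi> x"
proof -
  obtain K where "K \<in> \<pi>" "x \<in> K" using assms by (metis UNIV_I UnionE partition_onD1)
  then show "class_of \<pi> x \<in> \<pi>" "x \<in> class_of \<pi> x" using class_of_eq[OF assms] by auto
qed

lemma Ob_Pi_category:
  "Ob (Pi_category \<theta>) = {bar (fibres e) | e. e \<in> idempotents (regular_part (variant \<theta>))}"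
proof (intro equalityI subsetI)
  fix V assume "V \<in> Ob (Pi_category \<theta>)"
  then obtain \<pi> where p: "partition_on UNIV \<pi>" and s: "saturates (range \<theta>) \<pi>" and V: "V = bar \<pi>"
    by (auto simp: Pi_category_def set_category_def)
  have "\<forall>K\<in>\<pi>. \<exists>z. \<theta> z \<in> K" using s by (fastforce simp: saturates_def)
  then obtain z where z: "\<And>K. K \<in> \<pi> \<Longrightarrow> \<theta> (z K) \<in> K" by metis
  \<comment> \<open>Saturation provides in each class \<open>K\<close> a point
    \<open>\<theta> (z K)\<close>. Then \<open>\<theta> (e x)\<close> lies in the class of
    \<open>x\<close>, which makes \<open>e\<close> idempotent and lets it replace the
    partition.\<close>
  define e where "e x = z (class_of \<pi> x)" for x
  have cls: "class_of \<pi> (\<theta> (e x)) = class_of \<pi> x" for x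
    unfolding e_def using class_of_eq[OF p] class_of_mem[OF p] z by blast
  have e: "e \<in> idempotents (regular_part (variant \<theta>))"
    unfolding idempotent_iff using cls by (simp add: e_def)
  have "a \<in> bar \<pi> \<longleftrightarrow> a \<in> bar (fibres e)" for a
  proof
    assume a: "a \<in> bar \<pi>"
    have "a (\<theta> (e x)) = a x" for x
    proof -
      have "class_of \<pi> x \<in> \<pi>" "x \<in> class_of \<pi> x" "\<theta> (e x) \<in> class_of \<pi> x"
        using class_of_mem[OF p, of x] class_of_mem(2)[OF p, of "\<theta> (e x)"] cls by simp_all
      then show ?thesis using a unfolding bar_def by blast
    qed
    then show "a \<in> bar (fibres e)" unfolding bar_fibres_idempotent_iff[OF e] ..
  next
    assume a: "a \<in> bar (fibres e)"
    have "a x = a y" if "K \<in> \<pi>" "x \<in> K" "y \<in> K" for K x y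
    proof -
      have "e x = e y" using that class_of_eq[OF p] by (simp add: e_def)
      then show ?thesis using a unfolding bar_fibres_iff by blast
    qed
    then show "a \<in> bar \<pi>" unfolding bar_def by blast
  qed
  then have "V = bar (fibres e)" unfolding V by (rule set_eqI)
  then show "V \<in> {bar (fibres e) | e. e \<in> idempotents (regular_part (variant \<theta>))}"
    using e by (intro CollectI exI[of _ e] conjI)
next
  fix V assume "V \<in> {bar (fibres e) | e. e \<in> idempotents (regular_part (variant \<theta>))}"
  then obtain e where "e \<in> idempotents (regular_part (variant \<theta>))" and V: "V = bar (fibres e)"
    by (elim CollectE exE conjE)
  then have e: "e \<in> elems (regular_part (variant \<theta>))" by (intro idempotent_regular)
  show "V \<in> Ob (Pi_category \<theta>)"
    unfolding Pi_category_def set_category_def cat.simps V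
    using e partition_fibres[of e] unfolding variant_regular_iff
    by (intro CollectI exI[of _ "fibres e"] conjI) auto
qed

text \<open>A map \<eta> between classes is traded for a map \<open>p\<close> of points. An element
  of \<open>V\<close> is constant on classes, so composing it with \<eta> amounts to evaluating it
  at any chosen point of the image class. Different \<open>p\<close> may give the same
  morphism.\<close>

lemma Hom_Pi_category:
  assumes "V \<in> Ob (Pi_category \<theta>)" "W \<in> Ob (Pi_category \<theta>)"
  shows "Hom (Pi_category \<theta>) V W = {\<lambda>\<alpha>\<in>V. \<alpha> \<circ> p | p. \<forall>\<alpha>\<in>V. \<alpha> \<circ> p \<in> W}"
proof (intro equalityI subsetI)
  fix h assume "h \<in> Hom (Pi_category \<theta>) V W"
  then obtain \<pi>1 \<pi>2 \<eta> where h: "h = star_map \<pi>1 \<pi>2 \<eta>" and p1: "partition_on UNIV \<pi>1"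
    and p2: "partition_on UNIV \<pi>2" and V: "V = bar \<pi>1" and W: "W = bar \<pi>2" and eta: "\<eta> \<in> \<pi>2 \<rightarrow> \<pi>1"
    by (auto simp: Pi_category_def set_category_def)
  \<comment> \<open>A point is chosen in each class \<open>\<eta> K\<close>; \<open>p\<close> then
    sends all of \<open>K\<close> to it.\<close>
  have "\<forall>K\<in>\<pi>2. \<exists>y. y \<in> \<eta> K" using eta p1 by (metis PiE ex_in_conv partition_onD3)
  then obtain q where q: "\<And>K. K \<in> \<pi>2 \<Longrightarrow> q K \<in> \<eta> K" by metis
  define p where "p x = q (class_of \<pi>2 x)" for x
  have same: "p x = p y" if "K \<in> \<pi>2" "x \<in> K" "y \<in> K" for K x y
    using that class_of_eq[OF p2] by (simp add: p_def)
  have "\<alpha> \<circ> p \<in> W" for \<alpha>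
    unfolding W bar_def mem_Collect_eq comp_apply by (intro ballI arg_cong[of _ _ \<alpha>] same)
  moreover have "h = (\<lambda>\<alpha>\<in>V. \<alpha> \<circ> p)"
  proof
    fix \<alpha> show "h \<alpha> = (\<lambda>\<alpha>\<in>V. \<alpha> \<circ> p) \<alpha>"
    proof (cases "\<alpha> \<in> V")
      case True
      have "h \<alpha> x = \<alpha> (p x)" for x
        unfolding h p_def
        using star_map_apply[OF p1 p2 eta] True V class_of_mem[OF p2] q by blast
      then show ?thesis using True by (simp add: fun_eq_iff)
    qed (simp add: h star_map_def V)
  qed
  ultimately show "h \<in> {\<lambda>\<alpha>\<in>V. \<alpha> \<circ> p | p. \<forall>\<alpha>\<in>V. \<alpha> \<circ> p \<in> W}" by blast
next
  fix h assume "h \<in> {\<lambda>\<alpha>\<in>V. \<alpha> \<circ> p | p. \<forall>\<alpha>\<in>V. \<alpha> \<circ> p \<in> W}"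
  then obtain p where h: "h = (\<lambda>\<alpha>\<in>V. \<alpha> \<circ> p)" and p: "\<And>\<alpha>. \<alpha> \<in> V \<Longrightarrow> \<alpha> \<circ> p \<in> W" by blast
  obtain \<pi>1 \<pi>2 where p1: "partition_on UNIV \<pi>1" "saturates (range \<theta>) \<pi>1" "V = bar \<pi>1"
    and p2: "partition_on UNIV \<pi>2" "saturates (range \<theta>) \<pi>2" "W = bar \<pi>2"
    using assms by (auto simp: Pi_category_def set_category_def)
  \<comment> \<open>The class of the \<open>p\<close>-image of one representative of
    \<open>K\<close> suffices: \<open>\<alpha> \<circ> p\<close> is in \<open>W\<close>, so the
    value of \<alpha> does not depend on the representative.\<close>
  define \<eta> where "\<eta> K = class_of \<pi>1 (p (SOME k. k \<in> K))" for K
  have eta: "\<eta> \<in> \<pi>2 \<rightarrow> \<pi>1" using class_of_mem[OF p1(1)] by (simp add: \<eta>_def)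
  have "h = star_map \<pi>1 \<pi>2 \<eta>"
  proof
    fix \<alpha> show "h \<alpha> = star_map \<pi>1 \<pi>2 \<eta> \<alpha>"
    proof (cases "\<alpha> \<in> V")
      case True
      have "star_map \<pi>1 \<pi>2 \<eta> \<alpha> x = \<alpha> (p x)" for x
      proof -
        let ?K = "class_of \<pi>2 x"
        let ?k = "SOME k. k \<in> ?K"
        have K: "?K \<in> \<pi>2" "x \<in> ?K" using class_of_mem[OF p2(1)] by auto
        then have k: "?k \<in> ?K" by (metis someI)
        have "p ?k \<in> \<eta> ?K" unfolding \<eta>_def using class_of_mem[OF p1(1)] by blast
        then have "star_map \<pi>1 \<pi>2 \<eta> \<alpha> x = \<alpha> (p ?k)"
          using star_map_apply[OF p1(1) p2(1) eta _ K] True p1(3) by blast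
        moreover have "(\<alpha> \<circ> p) ?k = (\<alpha> \<circ> p) x"
          using p[OF True] K k unfolding p2(3) bar_def by blast
        ultimately show ?thesis by simp
      qed
      then show ?thesis using True by (simp add: h fun_eq_iff)
    qed (simp add: h star_map_def p1(3))
  qed
  then show "h \<in> Hom (Pi_category \<theta>) V W"
    using p1 p2 eta by (auto simp: Pi_category_def set_category_def)
qed

text \<open>In terms of precompositions, the identity comes from \<open>id\<close> and the composite
  of the morphisms given by \<open>p\<close> and \<open>q\<close> from
  \<open>p \<circ> q\<close>.\<close>

lemma is_category_Pi_category: "is_category (Pi_category \<theta>)"
proof -
  define Obs Homs where "Obs = Ob (Pi_category \<theta>)" and "Homs = Hom (Pi_category \<theta>)"
  have Pi: "Pi_category \<theta> = set_category Obs Homs"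
    by (simp add: Obs_def Homs_def Pi_category_def set_category_def)
  have Homs: "Homs V W = {\<lambda>\<alpha>\<in>V. \<alpha> \<circ> p | p. \<forall>\<alpha>\<in>V. \<alpha> \<circ> p \<in> W}" if "V \<in> Obs" "W \<in> Obs" for V W
    using that Hom_Pi_category unfolding Obs_def Homs_def by blast
  show ?thesis
    unfolding Pi
  proof (rule is_category_set_category)
    fix V W assume "V \<in> Obs" "W \<in> Obs"
    then show "Homs V W \<subseteq> V \<rightarrow>\<^sub>E W" by (auto simp: Homs)
  next
    fix V assume "V \<in> Obs"
    moreover have "(\<lambda>x\<in>V. x) = (\<lambda>\<alpha>\<in>V. \<alpha> \<circ> id)" by simp
    moreover have "\<forall>\<alpha>\<in>V. \<alpha> \<circ> id \<in> V" by simp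
    ultimately show "(\<lambda>x\<in>V. x) \<in> Homs V V" unfolding Homs[OF \<open>V \<in> Obs\<close> \<open>V \<in> Obs\<close>] by blast
  next
    fix V W U f g
    assume o: "V \<in> Obs" "W \<in> Obs" "U \<in> Obs" and "f \<in> Homs V W" "g \<in> Homs W U"
    then obtain p q where p: "f = (\<lambda>\<alpha>\<in>V. \<alpha> \<circ> p)" "\<forall>\<alpha>\<in>V. \<alpha> \<circ> p \<in> W"
      and q: "g = (\<lambda>\<alpha>\<in>W. \<alpha> \<circ> q)" "\<forall>\<alpha>\<in>W. \<alpha> \<circ> q \<in> U"
      unfolding Homs[OF o(1,2)] Homs[OF o(2,3)] by blast
    have "compose V g f = (\<lambda>\<alpha>\<in>V. \<alpha> \<circ> (p \<circ> q))"
      unfolding compose_def by (rule restrict_ext) (simp add: p q comp_assoc)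
    moreover have "\<forall>\<alpha>\<in>V. \<alpha> \<circ> (p \<circ> q) \<in> U" using p(2) q(2) by (simp add: comp_assoc[symmetric])
    ultimately show "compose V g f \<in> Homs V U" unfolding Homs[OF o(1,3)] by blast
  qed
qed

section \<open>Right ideals of idempotents and the isomorphism with
  \<open>Pi_category\<close>\<close>

lemma right_ideal_inject:
  assumes "e \<in> idempotents (regular_part (variant \<theta>))" "f \<in> idempotents (regular_part (variant \<theta>))"
    and "right_ideal (regular_part (variant \<theta>)) e = right_ideal (regular_part (variant \<theta>)) f"
  shows "bar (fibres e) = bar (fibres f)"
proof -
  have "e \<in> bar (fibres e)" "f \<in> bar (fibres f)" by (simp_all add: bar_fibres_iff)
  then have "e \<in> bar (fibres f)" "f \<in> bar (fibres e)"
    using assms(3) idempotent_regular[OF assms(1)] idempotent_regular[OF assms(2)]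
    unfolding assms(1,2)[THEN right_ideal_idempotent] by blast+
  \<comment> \<open>Membership of one idempotent in the other's \<open>bar\<close> set amounts to
    inclusion of the whole \<open>bar\<close> sets.\<close>
  then show ?thesis by (simp add: bar_fibres_subset_iff equalityI)
qed

text \<open>Left multiplication by \<open>w\<close> is precomposition with
  \<open>p = \<theta> \<circ> w\<close>. The condition on \<open>p\<close> is phrased with the full
  \<open>bar\<close> sets, not with the ideals, so that it coincides with the one in
  \<open>Hom_Pi_category\<close>.\<close>

lemma Hom_R_category:
  assumes e: "e \<in> idempotents (regular_part (variant \<theta>))"
    and f: "f \<in> idempotents (regular_part (variant \<theta>))"
  defines "R \<equiv> right_ideal (regular_part (variant \<theta>))"
  shows "Hom (R_category (regular_part (variant \<theta>))) (R e) (R f) =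
    {\<lambda>a\<in>R e. a \<circ> p | p. \<forall>\<alpha>\<in>bar (fibres e). \<alpha> \<circ> p \<in> bar (fibres f)}"
proof (intro equalityI subsetI)
  fix h assume "h \<in> Hom (R_category (regular_part (variant \<theta>))) (R e) (R f)"
  then obtain e' f' w where e': "e' \<in> idempotents (regular_part (variant \<theta>))" "R e = R e'"
    and f': "f' \<in> idempotents (regular_part (variant \<theta>))" "R f = R f'"
    and w: "w \<in> sandwich (regular_part (variant \<theta>)) f' e'"
    and h: "h = (\<lambda>a\<in>R e. \<lambda>x. a (\<theta> (w x)))"
    by (auto simp: R_category_def set_category_def lambda_map_def mul_variant R_def)
  have "bar (fibres f) = bar (fibres f')" using f f' right_ideal_inject unfolding R_def by blast
  then have "w \<in> bar (fibres f)" using w sandwich_idempotents[OF f'(1) e'(1)] by simp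
  then have "\<forall>\<alpha>\<in>bar (fibres e). \<alpha> \<circ> (\<theta> \<circ> w) \<in> bar (fibres f)"
    unfolding bar_fibres_iff comp_apply by metis
  moreover have "h = (\<lambda>a\<in>R e. a \<circ> (\<theta> \<circ> w))" by (simp add: h comp_def)
  ultimately show "h \<in> {\<lambda>a\<in>R e. a \<circ> p | p. \<forall>\<alpha>\<in>bar (fibres e). \<alpha> \<circ> p \<in> bar (fibres f)}" by blast
next
  fix h assume "h \<in> {\<lambda>a\<in>R e. a \<circ> p | p. \<forall>\<alpha>\<in>bar (fibres e). \<alpha> \<circ> p \<in> bar (fibres f)}"
  then obtain p where h: "h = (\<lambda>a\<in>R e. a \<circ> p)" and p: "\<And>\<alpha>. \<alpha> \<in> bar (fibres e) \<Longrightarrow> \<alpha> \<circ> p \<in> bar (fibres f)"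
    by blast
  have "e \<circ> p \<in> bar (fibres f)" by (rule p) (simp add: bar_fibres_iff)
  \<comment> \<open>The multiplier \<open>e \<circ> p\<close> realises \<open>p\<close> because
    every \<open>a\<close> in the right ideal satisfies
    \<open>a \<circ> \<theta> \<circ> e = a\<close>.\<close>
  then have "e \<circ> p \<in> sandwich (regular_part (variant \<theta>)) f e"
    unfolding sandwich_idempotents[OF f e] by auto
  moreover have "h = lambda_map (regular_part (variant \<theta>)) e (e \<circ> p)"
    unfolding h lambda_map_def mul_variant R_def
    by (rule restrict_ext)
      (simp add: right_ideal_idempotent[OF e] bar_fibres_idempotent_iff[OF e] fun_eq_iff)
  ultimately show "h \<in> Hom (R_category (regular_part (variant \<theta>))) (R e) (R f)"
    using e f by (auto simp: R_category_def set_category_def R_def)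
qed

lemma cat_isomorphic_R_category: "cat_isomorphic (R_category (regular_part (variant \<theta>))) (Pi_category \<theta>)"
proof -
  let ?S = "regular_part (variant \<theta>)"
  define G0 where "G0 V = V \<inter> elems ?S" for V
  define G1 :: "('a \<Rightarrow> 'a) set \<Rightarrow> ('a \<Rightarrow> 'a) set \<Rightarrow> (('a \<Rightarrow> 'a) \<Rightarrow> ('a \<Rightarrow> 'a)) \<Rightarrow> ('a \<Rightarrow> 'a) \<Rightarrow> ('a \<Rightarrow> 'a)"
    where "G1 V W h = restrict h (G0 V)" for V W h
  have obj: "\<exists>e. e \<in> idempotents ?S \<and> V = bar (fibres e)" if "V \<in> Ob (Pi_category \<theta>)" for V
    using that unfolding Ob_Pi_category by blast
  have G0: "G0 (bar (fibres e)) = right_ideal ?S e" if "e \<in> idempotents ?S" for e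
    using right_ideal_idempotent[OF that] by (simp add: G0_def)
  \<comment> \<open>The functor merely cuts a \<open>bar\<close> set down to its regular elements,
    so a precomposition keeps its defining \<open>p\<close>.\<close>
  have G1: "G1 V W (\<lambda>\<alpha>\<in>V. \<alpha> \<circ> p) = (\<lambda>\<alpha>\<in>G0 V. \<alpha> \<circ> p)" for V W p
    unfolding G1_def by (rule restrict_ext) (simp add: G0_def)
  show ?thesis
  proof (rule cat_isomorphicI[OF is_category_Pi_category, where ?G0.0 = G0 and ?G1.0 = G1])
    have "inj_on G0 (Ob (Pi_category \<theta>))"
    proof (rule inj_onI)
      fix V W assume "V \<in> Ob (Pi_category \<theta>)" "W \<in> Ob (Pi_category \<theta>)" "G0 V = G0 W"
      then show "V = W" using obj G0 right_ideal_inject by metis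
    qed
    moreover have "G0 ` Ob (Pi_category \<theta>) = Ob (R_category ?S)"
      by (force simp: Ob_Pi_category R_category_def set_category_def G0)
    ultimately show "bij_betw G0 (Ob (Pi_category \<theta>)) (Ob (R_category ?S))" by (simp add: bij_betw_def)
  next
    fix V W assume o: "V \<in> Ob (Pi_category \<theta>)" "W \<in> Ob (Pi_category \<theta>)"
    then obtain e f where e: "e \<in> idempotents ?S" "V = bar (fibres e)"
      and f: "f \<in> idempotents ?S" "W = bar (fibres f)"
      using obj by blast
    have "e \<in> G0 V" using idempotent_regular[OF e(1)] by (simp add: G0_def e(2) bar_fibres_iff)
    have "inj_on (G1 V W) (Hom (Pi_category \<theta>) V W)"
    proof (rule inj_onI)
      fix g h assume "g \<in> Hom (Pi_category \<theta>) V W" "h \<in> Hom (Pi_category \<theta>) V W"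
      then obtain p q where g: "g = (\<lambda>\<alpha>\<in>V. \<alpha> \<circ> p)" and h: "h = (\<lambda>\<alpha>\<in>V. \<alpha> \<circ> q)"
        unfolding Hom_Pi_category[OF o] by blast
      assume "G1 V W g = G1 V W h"
      \<comment> \<open>Restriction to regular elements loses nothing: \<open>e\<close> is regular,
        and every element of \<open>V\<close> factors through \<open>e\<close>, so agreement at
        \<open>e\<close> gives agreement on all of \<open>V\<close>.\<close>
      then have "(\<lambda>\<alpha>\<in>G0 V. \<alpha> \<circ> p) e = (\<lambda>\<alpha>\<in>G0 V. \<alpha> \<circ> q) e" by (simp only: g h G1)
      then have "e \<circ> p = e \<circ> q" using \<open>e \<in> G0 V\<close> by (simp only: restrict_apply')
      then have pq: "e (p x) = e (q x)" for x by (rule comp_eq_dest)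
      show "g = h"
        unfolding g h
      proof (rule restrict_ext)
        fix \<alpha> assume "\<alpha> \<in> V"
        then show "\<alpha> \<circ> p = \<alpha> \<circ> q"
          using pq unfolding e(2) bar_fibres_iff fun_eq_iff comp_apply by blast
      qed
    qed
    moreover have "G1 V W ` Hom (Pi_category \<theta>) V W = Hom (R_category ?S) (G0 V) (G0 W)"
    proof -
      have "G1 V W ` Hom (Pi_category \<theta>) V W = {\<lambda>\<alpha>\<in>G0 V. \<alpha> \<circ> p | p. \<forall>\<alpha>\<in>V. \<alpha> \<circ> p \<in> W}"
        unfolding Hom_Pi_category[OF o] setcompr_eq_image image_image G1 ..
      then show ?thesis
        using Hom_R_category[OF e(1) f(1)] by (simp add: e(2) f(2) G0[OF e(1)] G0[OF f(1)])
    qed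
    ultimately show "bij_betw (G1 V W) (Hom (Pi_category \<theta>) V W) (Hom (R_category ?S) (G0 V) (G0 W))"
      by (simp add: bij_betw_def)
  next
    fix V
    show "G1 V V (Ident (Pi_category \<theta>) V) = Ident (R_category ?S) (G0 V)"
      unfolding G1_def R_category_def Pi_category_def set_category_def cat.simps
      by (rule restrict_ext) (simp add: G0_def)
  next
    fix V W U g h
    assume o: "V \<in> Ob (Pi_category \<theta>)" "W \<in> Ob (Pi_category \<theta>)" and "g \<in> Hom (Pi_category \<theta>) V W"
    then obtain p where g: "g = (\<lambda>\<alpha>\<in>V. \<alpha> \<circ> p)" and p: "\<And>\<alpha>. \<alpha> \<in> V \<Longrightarrow> \<alpha> \<circ> p \<in> W"
      unfolding Hom_Pi_category[OF o] by blast
    obtain f where f: "f \<in> idempotents ?S" "W = bar (fibres f)" using o obj by blast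
    \<comment> \<open>Precomposition must keep \<open>a\<close> regular for the restrictions to
      compose. It shrinks the image, which preserves injectivity of \<theta>, and saturation comes
      from the idempotent \<open>f\<close> behind \<open>W\<close>.\<close>
    have "g a \<in> G0 W" if "a \<in> G0 V" for a
    proof -
      have a: "a \<in> V" "inj_on \<theta> (range a)" using that by (auto simp: G0_def regular_iff)
      have "inj_on \<theta> (range (a \<circ> p))" by (rule inj_on_subset[OF a(2)]) auto
      then have "a \<circ> p \<in> elems ?S" using regular_bar_fibres[OF f(1)] p[OF a(1)] f(2) by blast
      then show ?thesis using p a(1) by (simp add: g G0_def)
    qed
    then show "G1 V U (Comp (Pi_category \<theta>) V W U g h) =
        Comp (R_category ?S) (G0 V) (G0 W) (G0 U) (G1 V W g) (G1 W U h)"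
      unfolding G1_def R_category_def Pi_category_def set_category_def cat.simps compose_def
      by (intro restrict_ext) (simp add: G0_def)
  qed
qed

theorem theorem4p3:
  fixes \<theta> :: "'x \<Rightarrow> 'x"
  shows "semigroup_isomorphic (cross_connection_semigroup \<theta>) (regular_part (variant \<theta>)) \<and>
         cat_isomorphic (L_category (regular_part (variant \<theta>))) (P_category \<theta>) \<and>
         cat_isomorphic (R_category (regular_part (variant \<theta>))) (Pi_category \<theta>)"
  using semigroup_isomorphic_cross_connection cat_isomorphic_L_category cat_isomorphic_R_category
  by blast

end
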